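(* Let $V$ be a finite set of at least $8$ points on a $2$-sphere in $\mathbb{R}^3$. Then the number $N(V)$ of double-normal pairs in $V$ (as a subset of $\mathbb{R}^3$) satisfies \[N(V)\leq\frac{17}{4}|V|-6 .\] If equality holds, then $V$ is symmetric around the centre of the sphere, and the faces of the convex hull of $V$ are rectangles and acute triangles, with each vertex belonging to exactly $3$ rectangular faces. Conversely, for any nonempty finite subset $V$ of a $2$-sphere that is symmetric around the centre of the sphere and such that the faces of its convex hull are rectangles and triangles, with each vertex belonging to exactly $3$ rectangles, we have $N(V)=\frac{17}{4}|V|-6$.
   Context: For a finite set $V$ of points in $\mathbb{R}^3$, a double-normal pair of $V$ is an (unordered) pair $\{p,q\}$ of distinct points of $V$ such that $V$ lies in the closed strip bounded by the planes through $p$ and $q$, respectively, that are perpendicular to the segment $pq$. $N(V)$ denotes the number of double-normal pairs of $V$. A $2$-sphere in $\mathbb{R}^3$ is an ordinary round Euclidean sphere. "Faces" of the convex hull of $V$ means the two-dimensional faces of the polytope $\operatorname{conv} V$. (It is not required that both rectangles and triangles occur.) *)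

theory Defs
  imports "HOL-Analysis.Analysis"
begin

text \<open>The closed strip bounded by the planes through \<open>p\<close> and \<open>q\<close> with normal direction \<open>q - p\<close>.
  It is symmetric in \<open>p\<close> and \<open>q\<close>.\<close>

definition strip :: "'a::real_inner \<Rightarrow> 'a \<Rightarrow> 'a set" where
  "strip p q = {x. p \<bullet> (q - p) \<le> x \<bullet> (q - p) \<and> x \<bullet> (q - p) \<le> q \<bullet> (q - p)}"

definition double_normal_pairs :: "'a::real_inner set \<Rightarrow> 'a set set" where
  "double_normal_pairs V = {{p, q} | p q. p \<in> V \<and> q \<in> V \<and> p \<noteq> q \<and> V \<subseteq> strip p q}"

definition double_normal_number :: "'a::real_inner set \<Rightarrow> nat" where
  "double_normal_number V = card (double_normal_pairs V)"

text \<open>The point reflection in \<open>c\<close> is \<open>x \<mapsto> 2c - x\<close>.\<close>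

definition symmetric_around :: "'a::real_vector \<Rightarrow> 'a set \<Rightarrow> bool" where
  "symmetric_around c V \<longleftrightarrow> (\<forall>x\<in>V. 2 *\<^sub>R c - x \<in> V)"

definition two_faces :: "'a::euclidean_space set \<Rightarrow> 'a set set" where
  "two_faces S = {F. F face_of S \<and> aff_dim F = 2}"

text \<open>The angle \<open>b a c\<close> at the vertex \<open>a\<close>, meaningful when \<open>b\<close> and \<open>c\<close> differ from \<open>a\<close>.\<close>

definition angle_at :: "'a::real_inner \<Rightarrow> 'a \<Rightarrow> 'a \<Rightarrow> real" where
  "angle_at a b c = arccos (((b - a) \<bullet> (c - a)) / (norm (b - a) * norm (c - a)))"

text \<open>Rectangles and triangles are solid and nondegenerate. A rectangle is a parallelogram
  \<open>abcd\<close> with a right angle at \<open>a\<close>.\<close>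

definition is_rectangle :: "'a::real_inner set \<Rightarrow> bool" where
  "is_rectangle F \<longleftrightarrow> (\<exists>a b c d. a \<noteq> b \<and> a \<noteq> d \<and> c - b = d - a \<and>
     orthogonal (b - a) (d - a) \<and> F = convex hull {a, b, c, d})"

definition is_triangle :: "'a::real_inner set \<Rightarrow> bool" where
  "is_triangle F \<longleftrightarrow> (\<exists>a b c. \<not> collinear {a, b, c} \<and> F = convex hull {a, b, c})"

definition is_acute_triangle :: "'a::real_inner set \<Rightarrow> bool" where
  "is_acute_triangle F \<longleftrightarrow> (\<exists>a b c. \<not> collinear {a, b, c} \<and> F = convex hull {a, b, c} \<and>
     angle_at a b c < pi / 2 \<and> angle_at b c a < pi / 2 \<and> angle_at c a b < pi / 2)"

definition three_rectangles_at_each_vertex :: "'a::euclidean_space set \<Rightarrow> bool" where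
  "three_rectangles_at_each_vertex S \<longleftrightarrow>
     (\<forall>v. v extreme_point_of S \<longrightarrow> card {F \<in> two_faces S. is_rectangle F \<and> v \<in> F} = 3)"

end

theory Submission
  imports Defs
begin

text \<open>Let \<open>W\<close> be the union of \<open>V\<close> and its reflection in the centre. Two nonantipodal points
  \<open>p, q\<close> of \<open>V\<close> form a double-normal pair iff \<open>q, - p\<close> is a Gabriel pair of \<open>W\<close>: no point of
  \<open>W\<close> sees the segment at an obtuse angle. A Gabriel pair is an edge of \<open>conv W\<close> or a diameter of
  the circumcircle of a face. By Euler's formula, with \<open>n = card W\<close>, there are at most \<open>3n - 6\<close> of
  them plus the number of rectangular faces: triangulating a face with \<open>k\<close> vertices takes
  \<open>k - 3\<close> edges, and the number of its diameters, at most \<open>k/2\<close>, exceeds this only for a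
  rectangle. Since four nonacute face angles do not fit around a vertex, there are at most \<open>3n/4\<close>
  rectangles. If \<open>V\<close> is not symmetric, the bound follows by averaging the bounds for \<open>W\<close> and for
  the symmetric part of \<open>V\<close>.

  Faces are represented by their normals \<open>u\<close>, scaled such that the face lies in the plane
  \<open>{x. u \<bullet> x = 1}\<close> and \<open>u \<bullet> w \<le> 1\<close> on \<open>W\<close>. Gabriel pairs are counted as ordered pairs.\<close>

text \<open>On the sphere \<open>(x - z) \<bullet> (y - z)\<close> is an affine function of
  \<open>z\<close>, so being a Gabriel pair is a half-space condition: the plane through
  \<open>x\<close> and \<open>y\<close> with normal \<open>x + y\<close> supports \<open>W\<close>.
  This is what ties Gabriel pairs to faces. Scaling face normals to level 1 requires the origin to
  lie inside the hull, which holds because \<open>W\<close> is symmetric and, in the main case,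
  spans the space. Sets \<open>W\<close> in a plane through the origin are treated apart.

  Euler's formula comes from double counting along a generic linear functional: a face with
  \<open>k\<close> vertices has \<open>k - 2\<close> vertices strictly between its lowest and its
  highest one, and each point of \<open>W\<close> except the lowest and the highest is such an
  intermediate vertex of exactly two faces.

  For ordered pairs the bound reads
  \<open>2 * card (gabriel_pairs W) + 24 \<le> 15 * card W\<close>: the \<open>24\<close> and
  \<open>12\<close> of the \<open>15\<close> come from Euler's formula, the other \<open>3\<close>
  from the rectangles. It is false for the empty set, so the averaging breaks down when
  \<open>V\<close> contains no antipodal pair; the loss is then made up for by the size of
  \<open>V\<close>.\<close>

section \<open>Geometric and combinatorial preliminaries\<close>

text \<open>Read \<open>(X i, Y i, Z i)\<close> as homogeneous coordinates of the planar point
  \<open>(X i / Z i, Y i / Z i)\<close>. The line \<open>x = t - m * y\<close> has all points on its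
  left and touches some strictly above and some strictly below the axis \<open>y = 0\<close>: it
  carries the rightmost hull edge crossing the axis.\<close>

lemma crossing_support_line_exists:
  fixes X Y Z :: "'a \<Rightarrow> real"
  assumes "finite I" and Z: "\<And>i. i \<in> I \<Longrightarrow> 0 < Z i"
    and ex: "\<exists>i\<in>I. 0 < Y i" "\<exists>j\<in>I. Y j < 0" and Y: "\<And>i. i \<in> I \<Longrightarrow> Y i \<noteq> 0"
  obtains t m where "\<And>i. i \<in> I \<Longrightarrow> X i \<le> t * Z i - m * Y i"
    and "\<exists>i\<in>I. 0 < Y i \<and> X i = t * Z i - m * Y i"
    and "\<exists>j\<in>I. Y j < 0 \<and> X j = t * Z j - m * Y j"
proof -
  define A B where "A = {i\<in>I. 0 < Y i}" and "B = {j\<in>I. Y j < 0}"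
  \<comment> \<open>\<open>T (i, j)\<close> is where the segment between the points \<open>i\<close>
    and \<open>j\<close> crosses the axis, namely at the combination with weights
    \<open>- Y j\<close> and \<open>Y i\<close>. The wanted line passes through the rightmost
    crossing.\<close>
  define T where "T = (\<lambda>(i,j). (X j * Y i - X i * Y j) / (Z j * Y i - Z i * Y j))"
  have AB: "finite (A \<times> B)" "A \<times> B \<noteq> {}"
    using \<open>finite I\<close> ex by (auto simp: A_def B_def)
  define t where "t = Max (T ` (A \<times> B))"
  have "t \<in> T ` (A \<times> B)"
    unfolding t_def using AB by (intro Max_in) auto
  then obtain i0 j0 where i0: "i0 \<in> A" and j0: "j0 \<in> B" and t: "t = T (i0, j0)"
    by auto
  define a where "a = (\<lambda>i. t * Z i - X i)"
  have den: "0 < Z j * Y i - Z i * Y j" if "i \<in> A" "j \<in> B" for i j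
  proof -
    have "0 < Z j * Y i" "Z i * Y j < 0"
      using that Z by (auto simp: A_def B_def mult_less_0_iff)
    then show ?thesis by linarith
  qed
  have le: "a i * Y j \<le> a j * Y i" if "i \<in> A" "j \<in> B" for i j
  proof -
    have "T (i, j) \<le> t"
      unfolding t_def using AB that by (intro Max_ge) auto
    then have "X j * Y i - X i * Y j \<le> t * (Z j * Y i - Z i * Y j)"
      using den[OF that] by (simp add: T_def pos_divide_le_eq)
    then show ?thesis
      by (simp add: a_def algebra_simps)
  qed
  have eq: "a i0 * Y j0 = a j0 * Y i0"
  proof -
    have "X j0 * Y i0 - X i0 * Y j0 = t * (Z j0 * Y i0 - Z i0 * Y j0)"
      using den[OF i0 j0] by (simp add: T_def t)
    then show ?thesis
      by (simp add: a_def algebra_simps)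
  qed
  have Y0: "0 < Y i0" "Y j0 < 0" "i0 \<in> I" "j0 \<in> I"
    using i0 j0 by (auto simp: A_def B_def)
  \<comment> \<open>The slope must satisfy \<open>m * Y i \<le> a i\<close> throughout, that is, lie
    between the quotients \<open>a j / Y j\<close> below the axis and \<open>a i / Y i\<close> above
    it. By \<open>le\<close> these bounds are compatible, and at the maximising pair they
    coincide.\<close>
  define m where "m = a i0 / Y i0"
  have mi: "m * Y i0 = a i0" and mj: "m * Y j0 = a j0"
    using Y0 eq by (auto simp: m_def field_simps)
  have "m * Y i \<le> a i" if "i \<in> I" for i
  proof (cases "0 < Y i")
    case True
    then have "a i * Y j0 \<le> m * Y i * Y j0"
      using le[of i j0] that j0 by (simp add: A_def mult_ac flip: mj)
    then show ?thesis
      using Y0 by (simp add: mult_le_cancel_right)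
  next
    case False
    then have "i \<in> B"
      using Y[OF that] that by (auto simp: B_def)
    then have "m * Y i * Y i0 \<le> a i * Y i0"
      using le[OF i0, of i] by (simp add: mult_ac flip: mi)
    then show ?thesis
      using Y0 by (simp add: mult_le_cancel_right)
  qed
  then have "X i \<le> t * Z i - m * Y i" if "i \<in> I" for i
    using that by (fastforce simp: a_def)
  moreover have "X i0 = t * Z i0 - m * Y i0" "X j0 = t * Z j0 - m * Y j0"
    using mi mj by (auto simp: a_def)
  ultimately show ?thesis
    using that Y0 by blast
qed

text \<open>The second line touches points on both sides of the axis, and the one on the side where
  \<open>(m - m') * Y\<close> is nonnegative yields \<open>t' \<le> t\<close>. By exchanging the
  lines the intercepts agree, and then the two touching points bound the slope from both
  sides.\<close>

lemma crossing_support_line_unique: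
  fixes X Y Z :: "'a \<Rightarrow> real"
  assumes Z: "\<And>i. i \<in> I \<Longrightarrow> 0 < Z i"
    and le: "\<And>i. i \<in> I \<Longrightarrow> X i \<le> t * Z i - m * Y i"
    and ex: "\<exists>i\<in>I. 0 < Y i \<and> X i = t * Z i - m * Y i"
      "\<exists>j\<in>I. Y j < 0 \<and> X j = t * Z j - m * Y j"
    and le': "\<And>i. i \<in> I \<Longrightarrow> X i \<le> t' * Z i - m' * Y i"
    and ex': "\<exists>i\<in>I. 0 < Y i \<and> X i = t' * Z i - m' * Y i"
      "\<exists>j\<in>I. Y j < 0 \<and> X j = t' * Z j - m' * Y j"
  shows "t = t' \<and> m = m'"
proof -
  have ge: "t' \<le> t"
    if le: "\<And>i. i \<in> I \<Longrightarrow> X i \<le> t * Z i - m * Y i"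
      and ex': "\<exists>i\<in>I. 0 < Y i \<and> X i = t' * Z i - m' * Y i"
        "\<exists>j\<in>I. Y j < 0 \<and> X j = t' * Z j - m' * Y j" for t m t' m' :: real
  proof -
    obtain i j where i: "i \<in> I" "0 < Y i" "X i = t' * Z i - m' * Y i"
      and j: "j \<in> I" "Y j < 0" "X j = t' * Z j - m' * Y j"
      using ex' by blast
    have 1: "(m - m') * Y i \<le> (t - t') * Z i" "(m - m') * Y j \<le> (t - t') * Z j"
      using le[OF i(1)] le[OF j(1)] i(3) j(3) by (simp_all add: algebra_simps)
    show ?thesis
    proof (cases "m' \<le> m")
      case True
      then have "0 \<le> (t - t') * Z i"
        using 1(1) i(2) by (meson diff_ge_0_iff_ge mult_nonneg_nonneg order.trans less_imp_le)
      then show ?thesis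
        using Z[OF i(1)] by (simp add: zero_le_mult_iff)
    next
      case False
      then have "0 \<le> (t - t') * Z j"
        using 1(2) j(2) mult_nonpos_nonpos[of "m - m'" "Y j"] by linarith
      then show ?thesis
        using Z[OF j(1)] by (simp add: zero_le_mult_iff)
    qed
  qed
  have tt: "t = t'"
    using ge[OF le ex'] ge[OF le' ex] by simp
  obtain i j where i: "i \<in> I" "0 < Y i" "X i = t' * Z i - m' * Y i"
    and j: "j \<in> I" "Y j < 0" "X j = t' * Z j - m' * Y j"
    using ex' by blast
  have "m * Y i \<le> m' * Y i" "m * Y j \<le> m' * Y j"
    using le[OF i(1)] le[OF j(1)] i(3) j(3) tt by simp_all
  then have "m = m'"
    using i j by (simp add: mult_le_cancel_right)
  with tt show ?thesis by simp
qed

text \<open>Cramer's rule in the basis \<open>v\<close>, \<open>h\<close>,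
  \<open>cross3 v h\<close>, multiplied by the Gram determinant of \<open>v\<close> and
  \<open>h\<close> so that no independence has to be assumed. It supplies coordinates adapted to a
  vertex \<open>v\<close>.\<close>

lemma cross3_expansion:
  fixes v h p :: "real^3"
  shows "(cross3 v h \<bullet> cross3 v h) *\<^sub>R p =
    ((v \<bullet> p) * (h \<bullet> h) - (h \<bullet> p) * (v \<bullet> h)) *\<^sub>R v + ((h \<bullet> p) * (v \<bullet> v) - (v \<bullet> p) * (v \<bullet> h)) *\<^sub>R h
    + (p \<bullet> cross3 v h) *\<^sub>R cross3 v h"
  by (simp add: vec_eq_iff forall_3 cross_components inner_vec_def sum_3) (intro conjI; algebra)

lemma orthogonal_both_cross3:
  fixes v h p :: "real^3"
  assumes "cross3 v h \<noteq> 0" and "p \<bullet> v = 0" and "p \<bullet> h = 0"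
  obtains s where "p = s *\<^sub>R cross3 v h"
proof -
  have "(cross3 v h \<bullet> cross3 v h) *\<^sub>R p = (p \<bullet> cross3 v h) *\<^sub>R cross3 v h"
    using cross3_expansion[of v h p] assms by (simp add: inner_commute)
  moreover have "p = (1 / (cross3 v h \<bullet> cross3 v h)) *\<^sub>R ((cross3 v h \<bullet> cross3 v h) *\<^sub>R p)"
    using assms(1) by simp
  ultimately have "p = ((p \<bullet> cross3 v h) / (cross3 v h \<bullet> cross3 v h)) *\<^sub>R cross3 v h"
    by (metis scaleR_scaleR times_divide_eq_left mult_1)
  with that show ?thesis by blast
qed

lemma cross3_eq_0_imp_scaleR:
  fixes v h :: "real^3"
  assumes "cross3 v h = 0" and "v \<noteq> 0"
  obtains s where "h = s *\<^sub>R v"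
  using assms unfolding cross_eq_0 collinear_lemma by (metis scaleR_zero_left)

lemma cross3_orthogonal_nonzero:
  fixes v h :: "real^3"
  assumes "v \<bullet> h = 0" and "v \<noteq> 0" and "h \<noteq> 0"
  shows "cross3 v h \<noteq> 0"
proof
  assume "cross3 v h = 0"
  then obtain s where "h = s *\<^sub>R v"
    using cross3_eq_0_imp_scaleR assms by blast
  with assms show False by auto
qed

text \<open>On the line \<open>x + s *\<^sub>R d\<close> the sphere equation, divided by
  \<open>s\<close>, is linear in \<open>s\<close>; hence a line through \<open>x\<close> has at most
  one further point on the sphere.\<close>

lemma not_collinear_on_sphere:
  fixes x y z :: "'a::real_inner"
  assumes n: "x \<bullet> x = q" "y \<bullet> y = q" "z \<bullet> z = q" and d: "x \<noteq> y" "x \<noteq> z" "y \<noteq> z"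
  shows "\<not> collinear {x, y, z}"
proof
  assume "collinear {x, y, z}"
  then obtain d where "\<forall>a\<in>{x, y, z}. \<forall>b\<in>{x, y, z}. \<exists>c. a - b = c *\<^sub>R d"
    unfolding collinear_def by blast
  then obtain s t where "y - x = s *\<^sub>R d" "z - x = t *\<^sub>R d"
    by blast
  then have ys: "y = x + s *\<^sub>R d" "z = x + t *\<^sub>R d"
    by (simp_all add: algebra_simps)
  have "s * (2 * (x \<bullet> d) + s * (d \<bullet> d)) = 0" "t * (2 * (x \<bullet> d) + t * (d \<bullet> d)) = 0"
    using n ys by (simp_all add: algebra_simps inner_commute)
  moreover have "s \<noteq> 0" "t \<noteq> 0" "s \<noteq> t" "d \<bullet> d \<noteq> 0"
    using assms(4-6) ys by auto
  ultimately have "2 * (x \<bullet> d) + s * (d \<bullet> d) = 2 * (x \<bullet> d) + t * (d \<bullet> d)"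
    by simp
  with \<open>s \<noteq> t\<close> \<open>d \<bullet> d \<noteq> 0\<close> show False
    by simp
qed

lemma line_meets_sphere_twice:
  fixes u a x y z :: "real^3"
  assumes ua: "cross3 u a \<noteq> 0" and u: "u \<bullet> x = u \<bullet> y" "u \<bullet> x = u \<bullet> z" and a: "a \<bullet> x
      = a \<bullet> y" "a \<bullet> x = a \<bullet> z"
    and n: "x \<bullet> x = q" "y \<bullet> y = q" "z \<bullet> z = q" and d: "x \<noteq> y" "x \<noteq> z" "y \<noteq> z"
  shows False
proof -
  have line: "\<exists>s. v - w = s *\<^sub>R cross3 u a" if "v \<in> {x, y, z}" "w \<in> {x, y, z}" for v w
  proof (rule orthogonal_both_cross3[OF ua, of "v - w"])
    have "u \<bullet> v = u \<bullet> w" "a \<bullet> v = a \<bullet> w" using that u a by auto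
    then show "(v - w) \<bullet> u = 0" "(v - w) \<bullet> a = 0"
      by (simp_all add: inner_diff_left inner_diff_right inner_commute)
  qed blast
  then have "collinear {x, y, z}" unfolding collinear_def by blast
  with not_collinear_on_sphere[OF n d] show False by blast
qed

lemma plane_eqI_three_points:
  fixes u w x y z :: "real^3"
  assumes u: "u \<bullet> x = 1" "u \<bullet> y = 1" "u \<bullet> z = 1" and w: "w \<bullet> x = 1" "w \<bullet> y = 1" "w \<bullet> z = 1"
    and n: "x \<bullet> x = q" "y \<bullet> y = q" "z \<bullet> z = q" and d: "x \<noteq> y" "x \<noteq> z" "y \<noteq> z"
  shows "u = w"
proof (rule ccontr)
  assume "u \<noteq> w"
  have "u \<noteq> 0" using u by auto
  \<comment> \<open>Parallel normals with the same level 1 at \<open>x\<close> would be equal; so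
    the two planes are not parallel, and the three points would lie on their common line.\<close>
  have "cross3 u (u - w) \<noteq> 0"
  proof
    assume "cross3 u (u - w) = 0"
    then obtain s where s: "u - w = s *\<^sub>R u"
      using \<open>u \<noteq> 0\<close> cross3_eq_0_imp_scaleR by blast
    then have "(u - w) \<bullet> x = s"
      using u by simp
    then have "s = 0"
      using u w by (simp add: inner_diff_left)
    then show False
      using s \<open>u \<noteq> w\<close> by simp
  qed
  then show False
    using line_meets_sphere_twice[of u "u - w" x y z q] assms by (simp add: inner_diff_left)
qed

text \<open>The directions \<open>p1\<close>, \<open>p2\<close>, \<open>p3\<close> lie in the plane
  orthogonal to \<open>u\<close> and hence satisfy a linear relation. Pairing it with
  \<open>a1\<close>, \<open>a2\<close>, \<open>a3\<close> makes its coefficients pairwise of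
  opposite sign, which three numbers cannot be. This is what bounds the number of edges at a vertex
  of a polygon by two.\<close>

lemma no_three_extreme_directions:
  fixes u p1 p2 p3 a1 a2 a3 :: "real^3"
  assumes "u \<noteq> 0" and u: "u \<bullet> p1 = 0" "u \<bullet> p2 = 0" "u \<bullet> p3 = 0"
    and 1: "a1 \<bullet> p1 = 0" "a1 \<bullet> p2 < 0" "a1 \<bullet> p3 < 0"
    and 2: "a2 \<bullet> p1 < 0" "a2 \<bullet> p2 = 0" "a2 \<bullet> p3 < 0"
    and 3: "a3 \<bullet> p1 < 0" "a3 \<bullet> p2 < 0" "a3 \<bullet> p3 = 0"
  shows False
proof -
  \<comment> \<open>The planar determinants of the pairs, measured along \<open>u\<close>: they are
    the coefficients of the relation between coplanar vectors.\<close>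
  define c1 c2 c3 where "c1 = u \<bullet> cross3 p2 p3" and "c2 = u \<bullet> cross3 p3 p1" and "c3
      = u \<bullet> cross3 p1 p2"
  have "(p1 \<bullet> cross3 p2 p3) *\<^sub>R u = (u \<bullet> p1) *\<^sub>R cross3 p2 p3 + (u \<bullet> p2) *\<^sub>R cross3 p3 p1
      + (u \<bullet> p3) *\<^sub>R cross3 p1 p2"
    by (simp add: vec_eq_iff forall_3 cross_components inner_vec_def sum_3) (intro conjI; algebra)
  then have det: "p1 \<bullet> cross3 p2 p3 = 0"
    using u \<open>u \<noteq> 0\<close> by simp
  have "c1 *\<^sub>R p1 + c2 *\<^sub>R p2 + c3 *\<^sub>R p3 = (p1 \<bullet> cross3 p2 p3) *\<^sub>R u"
    by (simp add: c1_def c2_def c3_def vec_eq_iff forall_3 cross_components inner_vec_def sum_3)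
        (intro conjI; algebra)
  then have rel: "c1 *\<^sub>R p1 + c2 *\<^sub>R p2 + c3 *\<^sub>R p3 = 0"
    using det by simp
  have c: "c1 * (a \<bullet> p1) + c2 * (a \<bullet> p2) + c3 * (a \<bullet> p3) = 0" for a
    using arg_cong[OF rel, of "\<lambda>x. a \<bullet> x"] by (simp add: inner_add_right)
  have "c3 \<noteq> 0"
  proof
    assume "c3 = 0"
    have "p1 \<noteq> 0" using 2 by auto
    have "cross3 p1 p2 = 0"
    proof (rule ccontr)
      assume "cross3 p1 p2 \<noteq> 0"
      then obtain s where "u = s *\<^sub>R cross3 p1 p2"
        using u orthogonal_both_cross3 by metis
      then show False
        using \<open>c3 = 0\<close> \<open>u \<noteq> 0\<close> by (simp add: c3_def)
    qed
    then obtain s where "p2 = s *\<^sub>R p1"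
      using \<open>p1 \<noteq> 0\<close> cross3_eq_0_imp_scaleR by blast
    then show False using 1 by simp
  qed
  have opp: "s * t < 0" if "s * a + t * b = 0" "a < 0" "b < 0" "t \<noteq> 0" for s t a b :: real
  proof -
    have "s * a = - (t * b)" using that by simp
    moreover have "(s * t) * a = t * (s * a)" by simp
    ultimately have "(s * t) * a = - ((t * t) * b)" by simp
    moreover have "0 < t * t" using \<open>t \<noteq> 0\<close> by (auto simp: zero_less_mult_iff)
    then have "(t * t) * b < 0" using \<open>b < 0\<close> by (rule mult_pos_neg)
    ultimately have "0 < (s * t) * a" by linarith
    then show ?thesis
      using that(2) by (simp only: zero_less_mult_iff) auto
  qed
  have "c2 * c3 < 0" "c1 * c3 < 0"
    using opp[of c2 "a1 \<bullet> p2" c3 "a1 \<bullet> p3"] opp[of c1 "a2 \<bullet> p1" c3 "a2 \<bullet> p3"] c[of a1] c[of a2] 1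
        2 \<open>c3 \<noteq> 0\<close>
    by auto
  moreover have "c1 * c2 < 0"
    using opp[of c1 "a3 \<bullet> p1" c2 "a3 \<bullet> p2"] c[of a3] 3 calculation by (cases "c2 = 0") auto
  ultimately show False
    by (auto simp: mult_less_0_iff)
qed

section \<open>Finite counting and a generic height function\<close>

lemma even_card_involution:
  assumes "finite D" and "\<And>x. x \<in> D \<Longrightarrow> f x \<in> D" and "\<And>x. x \<in> D \<Longrightarrow> f (f x) = x"
    and "\<And>x. x \<in> D \<Longrightarrow> f x \<noteq> x"
  shows "even (card D)"
  using assms
proof (induction "card D" arbitrary: D rule: less_induct)
  case less
  show ?case
  proof (cases "D = {}")
    case False
    then obtain x where x: "x \<in> D" by blast
    define E where "E = D - {x, f x}"
    have sub: "{x, f x} \<subseteq> D" "card {x, f x} = 2"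
      using x less.prems(2)[OF x] less.prems(4)[OF x] by auto
    have card: "card D = card E + 2"
      using sub card_mono[OF less.prems(1) sub(1)] by (simp add: E_def card_Diff_subset)
    have "even (card E)"
    proof (rule less.hyps)
      show "f y \<in> E" if "y \<in> E" for y
      proof -
        have "y \<in> D" "y \<noteq> x" "y \<noteq> f x"
          using that by (auto simp: E_def)
        then have "f y \<noteq> x" "f y \<noteq> f x"
          using less.prems(3)[of y] less.prems(3)[OF x] by metis+
        then show ?thesis
          using less.prems(2)[OF \<open>y \<in> D\<close>] by (simp add: E_def)
      qed
      show "f (f y) = y" "f y \<noteq> y" if "y \<in> E" for y
        using that less.prems(3,4)[of y] by (simp_all add: E_def)
    qed (use card less.prems(1) in \<open>simp_all add: E_def\<close>)
    then show ?thesis using card by simp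
  qed simp
qed

text \<open>The functionals identifying some two points fill finitely many hyperplanes, which do not
  cover the space.\<close>

lemma exists_injective_functional:
  fixes W :: "'a::euclidean_space set"
  assumes "finite W"
  obtains h where "inj_on (\<lambda>w. h \<bullet> w) W"
proof -
  define H where "H = (\<lambda>(x,y). {h. (x - y) \<bullet> h = 0}) ` {(x,y) \<in> W \<times> W. x \<noteq> y}"
  have "finite H"
    unfolding H_def using assms by (intro finite_imageI) (auto intro: finite_subset[of _ "W \<times> W"])
  then have "negligible (\<Union>H)"
    by (rule negligible_Union) (auto simp: H_def intro!: negligible_hyperplane)
  then have "\<Union>H \<noteq> UNIV"
    using non_negligible_UNIV by metis
  then obtain h where h: "h \<notin> \<Union>H" by blast
  have "inj_on (\<lambda>w. h \<bullet> w) W"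
  proof (rule inj_onI, rule ccontr)
    fix x y assume "x \<in> W" "y \<in> W" "h \<bullet> x = h \<bullet> y" "x \<noteq> y"
    then have "{g. (x - y) \<bullet> g = 0} \<in> H"
      unfolding H_def by (intro image_eqI[where x = "(x, y)"]) auto
    moreover have "(x - y) \<bullet> h = 0"
      using \<open>h \<bullet> x = h \<bullet> y\<close> by (simp add: inner_diff_right inner_commute)
    ultimately have "h \<in> \<Union>H" by blast
    with h show False by blast
  qed
  with that show ?thesis by blast
qed

lemma card_le_2I:
  assumes "finite S" and "\<And>x y z. \<lbrakk>x \<in> S; y \<in> S; z \<in> S; x \<noteq> y; x \<noteq> z; y \<noteq> z\<rbrakk> \<Longrightarrow> False"
  shows "card S \<le> 2"
proof (rule ccontr)
  assume "\<not> card S \<le> 2"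
  then obtain T where "T \<subseteq> S" "card T = 3"
    using obtain_subset_with_card_n[of 3 S] by auto
  then obtain x y z where "T = {x,y,z}" "x \<noteq> y" "x \<noteq> z" "y \<noteq> z"
    by (auto simp: card_3_iff)
  with \<open>T \<subseteq> S\<close> assms(2)[of x y z] show False by auto
qed

lemma card_ge_3E:
  assumes "3 \<le> card S"
  obtains z where "z \<in> S" "z \<noteq> x" "z \<noteq> y"
proof -
  have "card {x, y} \<le> 2" by (simp add: card_insert_if)
  then have "\<not> S \<subseteq> {x, y}"
    using assms card_mono[of "{x, y}" S] by auto
  with that show ?thesis by blast
qed

section \<open>Gabriel pairs and facets of a symmetric set on a sphere\<close>

definition touching :: "'a::real_inner set \<Rightarrow> 'a \<Rightarrow> 'a set" where
  "touching W u = {w \<in> W. u \<bullet> w = 1}"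

text \<open>Three points of a sphere are never collinear, so three contact points already make the
  contact set two-dimensional.\<close>

definition facet_normals :: "'a::real_inner set \<Rightarrow> 'a set" where
  "facet_normals W = {u. (\<forall>w\<in>W. u \<bullet> w \<le> 1) \<and> 3 \<le> card (touching W u)}"

text \<open>Antipodal pairs are left out because the normal \<open>x + y\<close> vanishes for them;
  they enter the count of double-normal pairs separately.\<close>

definition gabriel_pairs :: "'a::real_inner set \<Rightarrow> ('a \<times> 'a) set" where
  "gabriel_pairs W = {(x, y). x \<in> W \<and> y \<in> W \<and> x \<noteq> y \<and> x \<noteq> - y \<and> (\<forall>z\<in>W. 0 \<le> (x - z) \<bullet> (y - z))}"

lemma touching_subset: "touching W u \<subseteq> W"
  by (auto simp: touching_def)

lemma gabriel_pairs_sym: "(x, y) \<in> gabriel_pairs W \<Longrightarrow> (y, x) \<in> gabriel_pairs W"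
  by (auto simp: gabriel_pairs_def inner_commute)

locale symmetric_sphere_set =
  fixes W :: "(real^3) set" and q :: real
  assumes finite_W: "finite W" and on_sphere: "w \<in> W \<Longrightarrow> w \<bullet> w = q" and q_pos: "0 < q"
    and uminus_W: "w \<in> W \<Longrightarrow> - w \<in> W"
begin

lemma inner_less_q:
  assumes "x \<in> W" "y \<in> W" "x \<noteq> y"
  shows "x \<bullet> y < q"
proof -
  have "0 < (x - y) \<bullet> (x - y)" using assms by simp
  also have "\<dots> = 2 * q - 2 * (x \<bullet> y)"
    using on_sphere assms by (simp add: inner_diff_left inner_diff_right inner_commute)
  finally show ?thesis by simp
qed

lemma inner_greater_minus_q:
  assumes "x \<in> W" "y \<in> W" "x \<noteq> - y"
  shows "- q < x \<bullet> y"
  using inner_less_q[OF assms(1) uminus_W[OF assms(2)] assms(3)] by simp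

lemma nonobtuse_iff:
  assumes "x \<in> W" "y \<in> W" "z \<in> W"
  shows "0 \<le> (x - z) \<bullet> (y - z) \<longleftrightarrow> (x + y) \<bullet> z \<le> q + x \<bullet> y"
  using on_sphere[OF assms(3)] by (auto simp: inner_simps inner_commute)

lemma finite_touching: "finite (touching W u)"
  using finite_subset[OF touching_subset finite_W] .

lemma finite_gabriel: "finite (gabriel_pairs W)"
  by (rule finite_subset[of _ "W \<times> W"]) (auto simp: gabriel_pairs_def finite_W)

lemma normal_eqI:
  assumes "{x, y, z} \<subseteq> touching W u" "{x, y, z} \<subseteq> touching W w" "x \<noteq> y" "x \<noteq> z" "y \<noteq> z"
  shows "u = w"
  using assms plane_eqI_three_points[of u x y z w q] by (simp add: touching_def on_sphere)

text \<open>Here \<open>W\<close> lies on a circle, and the supporting plane with normal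
  \<open>x + y\<close> meets it only in \<open>x\<close> and \<open>y\<close>. So a Gabriel pair is
  an edge of a convex polygon, and a vertex has at most two of them.\<close>

lemma gabriel_planar_le:
  assumes "u \<noteq> 0" and u: "\<And>w. w \<in> W \<Longrightarrow> u \<bullet> w = 0"
  shows "card (gabriel_pairs W) \<le> 2 * card W"
proof -
  have zero: "(x + y) \<bullet> (y - x) = 0" if "(x, y) \<in> gabriel_pairs W" for x y
    using that on_sphere[of x] on_sphere[of y]
    by (simp add: gabriel_pairs_def inner_simps inner_commute)
  have neg: "(x + y) \<bullet> (z - x) < 0"
    if "(x, y) \<in> gabriel_pairs W" "(x, z) \<in> gabriel_pairs W" "y \<noteq> z" for x y z
  proof -
    have xyz: "x \<in> W" "y \<in> W" "z \<in> W" "x \<noteq> y" "x \<noteq> z" "x \<noteq> - y"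
      using that by (auto simp: gabriel_pairs_def)
    have q: "x \<bullet> x = q" "y \<bullet> y = q" "z \<bullet> z = q"
      using xyz on_sphere by auto
    have "(x + y) \<bullet> z \<le> q + x \<bullet> y"
      using that xyz nonobtuse_iff by (auto simp: gabriel_pairs_def)
    moreover have xx: "(x + y) \<bullet> x = q + x \<bullet> y" "(x + y) \<bullet> y = q + x \<bullet> y"
      using q by (simp_all add: inner_simps inner_commute)
    moreover have "(x + y) \<bullet> z \<noteq> q + x \<bullet> y"
    proof
      assume "(x + y) \<bullet> z = q + x \<bullet> y"
      moreover have "x + y \<noteq> 0"
        using xyz(6) by (simp add: add_eq_0_iff2)
      then have "cross3 u (x + y) \<noteq> 0"
        using \<open>u \<noteq> 0\<close> u xyz by (intro cross3_orthogonal_nonzero) (auto simp: inner_add_right)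
      ultimately show False
        using line_meets_sphere_twice[of u "x + y" x y z q] u xyz q xx that(3) by simp
    qed
    ultimately show ?thesis by (simp add: inner_diff_right)
  qed
  have "card {y. (x, y) \<in> gabriel_pairs W} \<le> 2" for x
  proof (rule card_le_2I)
    show "finite {y. (x, y) \<in> gabriel_pairs W}"
      by (rule finite_subset[OF _ finite_W]) (auto simp: gabriel_pairs_def)
  next
    fix y1 y2 y3
    assume *: "y1 \<in> {y. (x, y) \<in> gabriel_pairs W}" "y2 \<in> {y. (x, y) \<in> gabriel_pairs W}"
      "y3 \<in> {y. (x, y) \<in> gabriel_pairs W}" "y1 \<noteq> y2" "y1 \<noteq> y3" "y2 \<noteq> y3"
    have "x \<in> W" "y1 \<in> W" "y2 \<in> W" "y3 \<in> W" 
      using * by (auto simp: gabriel_pairs_def)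
    then have "u \<bullet> (y1 - x) = 0" "u \<bullet> (y2 - x) = 0" "u \<bullet> (y3 - x) = 0"
      using u by (simp_all add: inner_diff_right)
    then show False
      using no_three_extreme_directions[of u "y1 - x" "y2 - x" "y3 - x" "x + y1" "x + y2" "x + y3"]
        zero neg * \<open>u \<noteq> 0\<close> by auto
  qed
  then have le: "(\<Sum>x\<in>W. card {y. (x, y) \<in> gabriel_pairs W}) \<le> 2 * card W"
    using sum_mono[of W "\<lambda>x. card {y. (x, y) \<in> gabriel_pairs W}" "\<lambda>_. 2"] by simp
  have "gabriel_pairs W = Sigma W (\<lambda>x. {y. (x, y) \<in> gabriel_pairs W})"
    by (auto simp: gabriel_pairs_def)
  then have "card (gabriel_pairs W) = card (Sigma W (\<lambda>x. {y. (x, y) \<in> gabriel_pairs W}))"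
    by (rule arg_cong)
  also have "\<dots> = (\<Sum>x\<in>W. card {y. (x, y) \<in> gabriel_pairs W})"
  proof (rule card_SigmaI[OF finite_W], rule ballI)
    show "finite {y. (x, y) \<in> gabriel_pairs W}" for x
      by (rule finite_subset[OF _ finite_W]) (auto simp: gabriel_pairs_def)
  qed
  also note le
  finally show ?thesis .
qed

end

locale spanning_sphere_set = symmetric_sphere_set +
  assumes spanning: "(\<And>w. w \<in> W \<Longrightarrow> a \<bullet> w = 0) \<Longrightarrow> a = 0"
begin

section \<open>Supporting planes through two given points\<close>

lemma exists_positive:
  assumes "a \<noteq> 0"
  obtains w where "w \<in> W" "0 < a \<bullet> w"
proof -
  obtain w where w: "w \<in> W" "a \<bullet> w \<noteq> 0"
    using spanning[of a] assms by auto
  then consider "0 < a \<bullet> w" | "0 < a \<bullet> - w"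
    by force
  then show ?thesis
    using that w uminus_W by metis
qed

text \<open>The plane of \<open>u\<close> is turned in the direction \<open>k\<close> until it hits
  the first point with positive \<open>k\<close>-value. No such point is touched at the start, which
  makes the parameter \<open>s\<close> positive.\<close>

lemma tilt:
  assumes u: "\<And>w. w \<in> W \<Longrightarrow> u \<bullet> w \<le> 1" and "k \<noteq> 0" and k: "\<And>w. w \<in> touching W u \<Longrightarrow> k \<bullet> w \<le> 0"
  obtains s w where "0 < s" "\<And>w. w \<in> W \<Longrightarrow> (u + s *\<^sub>R k) \<bullet> w \<le> 1" "0 < k \<bullet> w"
    "w \<in> touching W (u + s *\<^sub>R k)"
proof -
  define T where "T = {w \<in> W. 0 < k \<bullet> w}"
  define f where "f = (\<lambda>w. (1 - u \<bullet> w) / (k \<bullet> w))"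
  have T: "finite T" "T \<noteq> {}"
    using finite_W exists_positive[OF \<open>k \<noteq> 0\<close>] by (auto simp: T_def)
  have f: "0 < f w" if "w \<in> T" for w
  proof -
    have "u \<bullet> w \<noteq> 1" using that k[of w] by (auto simp: T_def touching_def)
    then show ?thesis using u[of w] that by (auto simp: f_def T_def)
  qed
  define s where "s = Min (f ` T)"
  have "s \<in> f ` T" unfolding s_def using T by (intro Min_in) auto
  then obtain w0 where w0: "w0 \<in> T" "s = f w0" by blast
  have "(u + s *\<^sub>R k) \<bullet> w \<le> 1" if "w \<in> W" for w
  proof (cases "w \<in> T")
    case True
    then have "s \<le> f w" unfolding s_def using T by (intro Min_le) auto
    then show ?thesis
      using True by (simp add: f_def T_def inner_add_left pos_le_divide_eq)
  next
    case False
    then have "s * (k \<bullet> w) \<le> 0"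
      using f[OF w0(1)] w0 that by (simp add: T_def mult_nonneg_nonpos)
    then show ?thesis using u[OF that] by (simp add: inner_add_left)
  qed
  moreover have "w0 \<in> touching W (u + s *\<^sub>R k)" "0 < k \<bullet> w0"
    using w0 by (auto simp: touching_def T_def f_def inner_add_left)
  ultimately show ?thesis
    using that f w0 by blast
qed

lemma inj_on_touching: "inj_on (touching W) (facet_normals W)"
proof (rule inj_onI)
  fix u w assume *: "u \<in> facet_normals W" "w \<in> facet_normals W" "touching W u = touching W w"
  then have c: "3 \<le> card (touching W u)" by (simp add: facet_normals_def)
  obtain x where "x \<in> touching W u" using c by (metis card_ge_3E)
  moreover obtain y where "y \<in> touching W u" "y \<noteq> x" using c by (metis card_ge_3E)
  moreover obtain z where "z \<in> touching W u" "z \<noteq> x" "z \<noteq> y" using c by (metis card_ge_3E)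
  ultimately show "u = w" using normal_eqI[of x y z u w] * by simp
qed

lemma finite_facet_normals: "finite (facet_normals W)"
proof (rule finite_imageD[OF _ inj_on_touching])
  show "finite (touching W ` facet_normals W)"
    by (rule finite_subset[of _ "Pow W"]) (auto simp: touching_def finite_W)
qed

lemma facet_normalsD:
  assumes "u \<in> facet_normals W"
  shows "w \<in> W \<Longrightarrow> u \<bullet> w \<le> 1" "3 \<le> card (touching W u)"
  using assms by (auto simp: facet_normals_def)

definition facets_through :: "real^3 \<Rightarrow> real^3 \<Rightarrow> (real^3) set" where
  "facets_through x y = {u \<in> facet_normals W. x \<in> touching W u \<and> y \<in> touching W u}"

lemma finite_facets_through: "finite (facets_through x y)"
  using finite_facet_normals by (simp add: facets_through_def)

lemma facets_through_commute: "facets_through x y = facets_through y x"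
  by (auto simp: facets_through_def)

lemma touching_not_antipodal:
  assumes "x \<in> touching W u" "y \<in> touching W u"
  shows "x \<noteq> - y"
  using assms by (auto simp: touching_def)

lemma cross3_touching_nonzero:
  assumes "x \<in> touching W u" "y \<in> touching W u" "x \<noteq> y"
  shows "cross3 x y \<noteq> 0"
proof
  assume "cross3 x y = 0"
  moreover have "x \<noteq> 0" using assms by (auto simp: touching_def)
  ultimately obtain s where s: "y = s *\<^sub>R x" using cross3_eq_0_imp_scaleR by blast
  then have "s = 1" using assms by (simp add: touching_def)
  with s assms show False by simp
qed

lemma facets_through_cross3:
  assumes "u \<bullet> x = 1" "u \<bullet> y = 1" "w \<bullet> x = 1" "w \<bullet> y = 1" "cross3 x y \<noteq> 0"
  obtains s where "w = u + s *\<^sub>R cross3 x y"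
proof -
  obtain s where "w - u = s *\<^sub>R cross3 x y"
    using orthogonal_both_cross3[of x y "w - u"] assms by (auto simp: inner_diff_left)
  then have "w = u + s *\<^sub>R cross3 x y" by (simp add: algebra_simps)
  with that show ?thesis .
qed

text \<open>The normals of the planes through \<open>x\<close> and \<open>y\<close> form a line with
  direction \<open>k\<close>. At a third point of a facet the sign of \<open>k\<close> shows on
  which side of its normal all other supporting normals lie; two facets with the same sign would
  each lie on that same side of the other. So the sign is injective on the facets.\<close>

lemma card_facets_through_le:
  assumes "x \<noteq> y"
  shows "card (facets_through x y) \<le> 2"
proof -
  define k where "k = cross3 x y"
  have k: "k \<bullet> x = 0" "k \<bullet> y = 0"
    by (simp_all add: k_def dot_cross_self inner_commute)
  define g where "g u = (SOME z. z \<in> touching W u \<and> z \<noteq> x \<and> z \<noteq> y)" for u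
  have g: "g u \<in> touching W u" "g u \<noteq> x" "g u \<noteq> y" if "u \<in> facets_through x y" for u
  proof -
    have "\<exists>z. z \<in> touching W u \<and> z \<noteq> x \<and> z \<noteq> y"
      using that facet_normalsD(2) card_ge_3E unfolding facets_through_def
          by (metis (lifting) mem_Collect_eq)
    then show "g u \<in> touching W u" "g u \<noteq> x" "g u \<noteq> y"
      unfolding g_def by (metis (mono_tags, lifting) someI_ex)+
  qed
  have le: "s * (k \<bullet> g u) \<le> 0" if "u \<in> facets_through x y" "u + s *\<^sub>R k \<in> facets_through x y"
      for u s
    using g[OF that(1)] that(2) facet_normalsD(1)[of "u + s *\<^sub>R k" "g u"]
    by (auto simp: facets_through_def touching_def inner_add_left)
  have nz: "k \<bullet> g u \<noteq> 0" if u: "u \<in> facets_through x y" for u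
  proof
    assume z: "k \<bullet> g u = 0"
    have "{x, y, g u} \<subseteq> touching W u" "{x, y, g u} \<subseteq> touching W (u + k)"
      using u g[OF u] z k by (auto simp: facets_through_def touching_def inner_add_left)
    then have "u = u + k"
      using normal_eqI g[OF u] assms by metis
    then show False
      using u assms cross3_touching_nonzero by (auto simp: facets_through_def k_def)
  qed
  have "inj_on (\<lambda>u. 0 < k \<bullet> g u) (facets_through x y)"
  proof (rule inj_onI)
    fix u w assume u: "u \<in> facets_through x y" and w: "w \<in> facets_through x y"
      and eq: "(0 < k \<bullet> g u) = (0 < k \<bullet> g w)"
    obtain s where s: "w = u + s *\<^sub>R k"
      unfolding k_def using u w assms cross3_touching_nonzero
      by (auto simp: facets_through_def touching_def intro: facets_through_cross3[of u x y w])
    then have "u = w + (- s) *\<^sub>R k" by simp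
    then have "s * (k \<bullet> g u) \<le> 0" "(- s) * (k \<bullet> g w) \<le> 0"
      using le[OF u, of s] le[OF w, of "- s"] u w s by auto
    then have "s = 0"
      using nz[OF u] nz[OF w] eq by (auto simp: mult_le_0_iff zero_le_mult_iff)
    then show "u = w" using s by simp
  qed
  then have "card (facets_through x y) \<le> card (UNIV :: bool set)"
    by (intro card_inj_on_le) auto
  then show ?thesis by simp
qed

text \<open>The functional \<open>k\<close> exhibits the segment as an edge of the face of
  \<open>u\<close>; tilting about this edge produces the neighbouring facet.\<close>

lemma two_facets_through:
  assumes u: "u \<in> facet_normals W" and xy: "x \<in> touching W u" "y \<in> touching W u" "x \<noteq> y"
    and k: "k \<noteq> 0" "k \<bullet> x = 0" "k \<bullet> y = 0" "\<And>w. w \<in> touching W u \<Longrightarrow> k \<bullet> w \<le> 0"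
  shows "card (facets_through x y) = 2"
proof -
  obtain s w where s: "0 < s" "\<And>w. w \<in> W \<Longrightarrow> (u + s *\<^sub>R k) \<bullet> w \<le> 1" "0 < k \<bullet> w"
    "w \<in> touching W (u + s *\<^sub>R k)"
    using tilt[of u k] u k facet_normalsD(1) by metis
  have "{x, y, w} \<subseteq> touching W (u + s *\<^sub>R k)"
    using xy k s by (auto simp: touching_def inner_add_left)
  moreover have "card {x, y, w} = 3"
    using xy(3) k(2,3) s(3) by (auto simp: card_insert_if)
  ultimately have "3 \<le> card (touching W (u + s *\<^sub>R k))"
    using card_mono[OF finite_touching] by metis
  then have "{u, u + s *\<^sub>R k} \<subseteq> facets_through x y"
    using s xy u k by (auto simp: facets_through_def facet_normals_def touching_def inner_add_left)
  moreover have "card {u, u + s *\<^sub>R k} = 2" using s k by simp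
  ultimately have "2 \<le> card (facets_through x y)"
    using card_mono[OF finite_facets_through] by metis
  with card_facets_through_le[OF xy(3)] show ?thesis by simp
qed

text \<open>The plane through \<open>x\<close> and \<open>y\<close> with normal along
  \<open>x + y\<close> supports \<open>W\<close>. If it touches a third point, it is one of the at
  most two facets through the pair; otherwise it can be turned about the pair in both directions
  until it becomes a facet. The singleton alternative is the case of a diameter.\<close>

lemma gabriel_facets_through:
  assumes "(x, y) \<in> gabriel_pairs W"
  shows "card (facets_through x y) = 2 \<or> facets_through x y = {(1 / (q + x \<bullet> y)) *\<^sub>R (x + y)}"
proof -
  have xy: "x \<in> W" "y \<in> W" "x \<noteq> y" "x \<noteq> - y" and G: "\<And>z. z \<in> W \<Longrightarrow> 0 \<le> (x - z) \<bullet> (y - z)"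
    using assms by (auto simp: gabriel_pairs_def)
  have pos: "0 < q + x \<bullet> y"
    using inner_greater_minus_q[OF xy(1,2,4)] by simp
  define u where "u = (1 / (q + x \<bullet> y)) *\<^sub>R (x + y)"
  have ule: "u \<bullet> z \<le> 1" if "z \<in> W" for z
    using G[OF that] nonobtuse_iff[OF xy(1,2) that] pos by (simp add: u_def)
  have u1: "u \<bullet> x = 1" "u \<bullet> y = 1"
    using pos on_sphere xy by (simp_all add: u_def inner_simps inner_commute)
  then have ux: "x \<in> touching W u" "y \<in> touching W u"
    using xy by (auto simp: touching_def)
  define k where "k = cross3 x y"
  have k: "k \<bullet> x = 0" "k \<bullet> y = 0" "k \<noteq> 0"
    using cross3_touching_nonzero ux xy by (auto simp: k_def dot_cross_self inner_commute)
  show ?thesis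
  proof (cases "3 \<le> card (touching W u)")
    case True
    then have uN: "u \<in> facets_through x y"
      using ule ux by (auto simp: facet_normals_def facets_through_def)
    show ?thesis
    proof (cases "card (facets_through x y) = 2")
      case False
      moreover have "card (facets_through x y) \<noteq> 0"
        using uN finite_facets_through by auto
      ultimately have "card (facets_through x y) = 1"
        using card_facets_through_le[OF xy(3)] by linarith
      then show ?thesis
        using uN by (metis card_1_singletonE singletonD u_def)
    qed simp
  next
    case False
    then have F: "touching W u = {x, y}"
      using ux card_ge_3E xy(3) finite_touching[of u] card_seteq[of "touching W u" "{x,y}"] by simp
    obtain s w where s: "0 < s" "\<And>w. w \<in> W \<Longrightarrow> (u + s *\<^sub>R k) \<bullet> w \<le> 1" "0 < k \<bullet> w"
        "w \<in> touching W (u + s *\<^sub>R k)"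
      using tilt[of u k] ule k F by (metis (no_types, lifting) insertE order_refl singletonD)
    have "{x, y, w} \<subseteq> touching W (u + s *\<^sub>R k)"
      using xy u1 k s by (auto simp: touching_def inner_add_left)
    moreover have "card {x, y, w} = 3"
      using xy(3) k(1,2) s(3) by (auto simp: card_insert_if)
    ultimately have "3 \<le> card (touching W (u + s *\<^sub>R k))"
      using card_mono[OF finite_touching] by metis
    then have 1: "u + s *\<^sub>R k \<in> facet_normals W"
      using s by (auto simp: facet_normals_def)
    have "{x, y} \<subseteq> touching W (u + s *\<^sub>R k)"
      using \<open>{x, y, w} \<subseteq> touching W (u + s *\<^sub>R k)\<close> by auto
    \<comment> \<open>The original plane still supports \<open>W\<close>, so the new facet lies
      entirely on the side to which the plane was turned. Turning back past the original plane gives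
      the second facet.\<close>
    moreover have "- k \<bullet> z \<le> 0" if z: "z \<in> touching W (u + s *\<^sub>R k)" for z
    proof -
      have "u \<bullet> z \<le> 1" "u \<bullet> z + s * (k \<bullet> z) = 1"
        using z ule by (auto simp: touching_def inner_add_left)
      then have "0 \<le> s * (k \<bullet> z)" by linarith
      then show ?thesis using \<open>0 < s\<close> by (simp add: zero_le_mult_iff)
    qed
    ultimately have "card (facets_through x y) = 2"
      using two_facets_through[of "u + s *\<^sub>R k" x y "- k"] 1 k xy by simp
    then show ?thesis by simp
  qed
qed

text \<open>If a second facet contains \<open>x\<close> and \<open>y\<close>, the difference of the
  two normals is a functional that vanishes along this segment and is negative at the rest of the
  face. Three such segments cannot start at \<open>x\<close>.\<close>

lemma card_neighbours_in_facet:
  assumes u: "u \<in> facet_normals W" and x: "x \<in> touching W u"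
  shows "card {y \<in> touching W u. y \<noteq> x \<and> card (facets_through x y) = 2} \<le> 2" (is "card ?S \<le> 2")
proof (rule card_le_2I)
  show "finite ?S" using finite_touching by auto
next
  fix y1 y2 y3 assume y: "y1 \<in> ?S" "y2 \<in> ?S" "y3 \<in> ?S" "y1 \<noteq> y2" "y1 \<noteq> y3" "y2 \<noteq> y3"
  have a: "\<exists>a. a \<bullet> (y - x) = 0 \<and> (\<forall>z\<in>touching W u. z \<noteq> x \<longrightarrow> z \<noteq> y \<longrightarrow> a \<bullet> (z - x) < 0)" if "y \<in> ?S"
      for y
  proof -
    have "\<not> facets_through x y \<subseteq> {u}"
      using that card_mono[of "{u}" "facets_through x y"] by auto
    then obtain w where w: "w \<in> facets_through x y" "w \<noteq> u" by blast
    have "(w - u) \<bullet> (y - x) = 0"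
      using w that x by (simp add: facets_through_def touching_def inner_diff_left inner_diff_right)
    moreover have "(w - u) \<bullet> (z - x) < 0" if z: "z \<in> touching W u" "z \<noteq> x" "z \<noteq> y" for z
    proof -
      have "w \<bullet> z \<noteq> 1"
      proof
        assume "w \<bullet> z = 1"
        then have "{x, y, z} \<subseteq> touching W u" "{x, y, z} \<subseteq> touching W w"
          using w z x \<open>y \<in> ?S\<close> by (auto simp: facets_through_def touching_def)
        then show False using normal_eqI[of x y z] w z \<open>y \<in> ?S\<close> by auto
      qed
      moreover have "w \<bullet> z \<le> 1" using w z facet_normalsD(1)[of w z]
          by (auto simp: facets_through_def touching_def)
      moreover have "u \<bullet> z = 1" "u \<bullet> x = 1" "w \<bullet> x = 1"
        using w z x by (auto simp: facets_through_def touching_def)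
      ultimately show ?thesis
        by (simp add: inner_diff_left inner_diff_right)
    qed
    ultimately show ?thesis by blast
  qed
  obtain a1 where a1: "a1 \<bullet> (y1 - x) = 0" "\<And>z. z\<in>touching W u \<Longrightarrow> z \<noteq> x \<Longrightarrow> z \<noteq> y1 \<Longrightarrow> a1 \<bullet> (z - x) < 0"
    using a[OF y(1)] by blast
  obtain a2 where a2: "a2 \<bullet> (y2 - x) = 0" "\<And>z. z\<in>touching W u \<Longrightarrow> z \<noteq> x \<Longrightarrow> z \<noteq> y2 \<Longrightarrow> a2 \<bullet> (z - x) < 0"
    using a[OF y(2)] by blast
  obtain a3 where a3: "a3 \<bullet> (y3 - x) = 0" "\<And>z. z\<in>touching W u \<Longrightarrow> z \<noteq> x \<Longrightarrow> z \<noteq> y3 \<Longrightarrow> a3 \<bullet> (z - x) < 0"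
    using a[OF y(3)] by blast
  have "u \<noteq> 0" using x by (auto simp: touching_def)
  moreover have "u \<bullet> (y1 - x) = 0" "u \<bullet> (y2 - x) = 0" "u \<bullet> (y3 - x) = 0"
    using x y by (auto simp: touching_def inner_diff_right)
  ultimately show False
    using no_three_extreme_directions[of u "y1 - x" "y2 - x" "y3 - x" a1 a2 a3] a1 a2 a3 y by auto
qed

end

section \<open>Euler's formula and nonacute face angles\<close>

lemma sum_card_swap:
  assumes "finite A" "finite B"
  shows "(\<Sum>a\<in>A. card {b\<in>B. P a b}) = (\<Sum>b\<in>B. card {a\<in>A. P a b})"
proof -
  have "(\<Sum>a\<in>A. card {b\<in>B. P a b}) = (\<Sum>a\<in>A. \<Sum>b\<in>B. if P a b then 1 else 0)"
    using assms by (intro sum.cong refl) (simp add: sum.If_cases Int_def)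
  also have "\<dots> = (\<Sum>b\<in>B. \<Sum>a\<in>A. if P a b then 1 else 0)"
    by (rule sum.swap)
  also have "\<dots> = (\<Sum>b\<in>B. card {a\<in>A. P a b})"
    using assms by (intro sum.cong refl) (simp add: sum.If_cases Int_def)
  finally show ?thesis .
qed

lemma card_strictly_between:
  fixes g :: "'a \<Rightarrow> real"
  assumes "finite S" and "2 \<le> card S" and inj: "inj_on g S"
  shows "card {v\<in>S. (\<exists>w\<in>S. g v < g w) \<and> (\<exists>z\<in>S. g z < g v)} = card S - 2"
proof -
  have "S \<noteq> {}" using assms by auto
  then have "Max (g ` S) \<in> g ` S" "Min (g ` S) \<in> g ` S"
    using \<open>finite S\<close> by (auto intro: Max_in Min_in)
  then obtain a b where a: "a \<in> S" "g a = Max (g ` S)" and b: "b \<in> S" "g b = Min (g ` S)"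
    by auto
  have le: "g b \<le> g v" "g v \<le> g a" if "v \<in> S" for v
    using that a b \<open>finite S\<close> by auto
  have "a \<noteq> b"
  proof
    assume "a = b"
    then have "g v = g a" if "v \<in> S" for v using le[OF that] by simp
    then have "S \<subseteq> {a}" using inj a(1) by (auto dest: inj_onD)
    then have "card S \<le> 1" using card_mono[of "{a}" S] by simp
    with assms show False by simp
  qed
  have "g v < g a" if "v \<in> S" "v \<noteq> a" for v
    using le[OF that(1)] inj_onD[OF inj _ that(1) a(1)] that(2) by (cases "g v = g a") auto
  moreover have "g b < g v" if "v \<in> S" "v \<noteq> b" for v
    using le[OF that(1)] inj_onD[OF inj _ that(1) b(1)] that(2) by (cases "g v = g b") auto
  ultimately have "{v\<in>S. (\<exists>w\<in>S. g v < g w) \<and> (\<exists>z\<in>S. g z < g v)} = S - {a, b}"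
    using a(1) b(1) le by (auto simp: not_le[symmetric])
  then show ?thesis
    using a b \<open>a \<noteq> b\<close> \<open>finite S\<close> by (simp add: card_Diff_subset)
qed

context spanning_sphere_set
begin

lemma card_W_ge_2: "2 \<le> card W"
proof -
  have "axis 1 1 \<noteq> (0 :: real^3)" by (simp add: axis_eq_0_iff)
  then obtain w where w: "w \<in> W" by (rule exists_positive)
  have "w \<noteq> - w"
  proof
    assume "w = - w"
    then have "w \<bullet> w = - (w \<bullet> w)" by (metis inner_minus_left)
    then show False using on_sphere[OF w(1)] q_pos by simp
  qed
  then have "card {w, - w} = 2" by simp
  then show ?thesis
    using card_mono[OF finite_W, of "{w, - w}"] w uminus_W by auto
qed

section \<open>Euler's formula along a height function\<close>

definition facets_across :: "real^3 \<Rightarrow> real^3 \<Rightarrow> (real^3) set" where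
  "facets_across v h = {u \<in> facet_normals W. v \<in> touching W u \<and>
    (\<exists>w\<in>touching W u. h \<bullet> v < h \<bullet> w) \<and> (\<exists>z\<in>touching W u. h \<bullet> z < h \<bullet> v)}"

text \<open>The stereographic projection from \<open>v\<close> turns the facets at \<open>v\<close> into the edges of a convex
    polygon
  and the plane through \<open>v\<close> with normal \<open>h\<close> into a line. A polygon has exactly two edges that
      cross a
  given line separating its vertices; \<open>u \<bullet> cross3 v h\<close> tells the two sides apart.\<close>

lemma facets_across_side:
  assumes v: "v \<in> W" and inj: "inj_on (\<lambda>w. h \<bullet> w) W"
    and up: "\<exists>w\<in>W. h \<bullet> v < h \<bullet> w" and down: "\<exists>z\<in>W. h \<bullet> z < h \<bullet> v"
  shows "\<exists>u. {u \<in> facets_across v h. 0 < u \<bullet> cross3 v h} = {u}"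
    and "u \<in> facets_across v h \<Longrightarrow> u \<bullet> cross3 v h \<noteq> 0"
proof -
  define k where "k = cross3 v h"
  define K where "K = k \<bullet> k"
  have "v \<noteq> 0" using on_sphere[OF v] q_pos by auto
  \<comment> \<open>\<open>Z w\<close> is proportional to the distance of \<open>w\<close> from the
    tangent plane at \<open>v\<close>, so \<open>X w / Z w\<close> and \<open>Y w / Z w\<close> are
    affine coordinates of the stereographic projection of \<open>w\<close> from
    \<open>v\<close>.\<close>
  define X Y Z where "X w = k \<bullet> (w - v)" and "Y w = h \<bullet> (w - v)" and "Z w = q - v \<bullet> w" for w
  have Zpos: "0 < Z w" if "w \<in> W - {v}" for w
    using inner_less_q[OF v, of w] that by (auto simp: Z_def)
  have Ynz: "Y w \<noteq> 0" if "w \<in> W - {v}" for w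
    using inj_onD[OF inj, of w v] that v by (auto simp: Y_def inner_diff_right)
  \<comment> \<open>Otherwise \<open>h\<close> is a multiple of \<open>v\<close>, and
    \<open>v\<close> would be a highest or a lowest point, against \<open>up\<close> and
    \<open>down\<close>.\<close>
  have "k \<noteq> 0"
  proof
    assume "k = 0"
    then obtain c where c: "h = c *\<^sub>R v"
      using \<open>v \<noteq> 0\<close> cross3_eq_0_imp_scaleR unfolding k_def by blast
    have "h \<bullet> (w - v) = - c * Z w" for w
      using on_sphere[OF v] by (simp add: c Z_def inner_diff_right algebra_simps)
    then have Yc: "Y w = - c * Z w" for w by (simp add: Y_def)
    obtain w z where wz: "w \<in> W - {v}" "0 < Y w" "z \<in> W - {v}" "Y z < 0"
      using up down by (force simp: Y_def inner_diff_right)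
    then show False
      using Zpos[of w] Zpos[of z] by (auto simp: Yc mult_less_0_iff zero_less_mult_iff)
  qed
  then have K: "0 < K" by (simp add: K_def)
  have kv: "k \<bullet> v = 0" "k \<bullet> h = 0"
    by (simp_all add: k_def dot_cross_self inner_commute)
  define A B where "A u = (v \<bullet> u) * (h \<bullet> h) - (h \<bullet> u) * (v \<bullet> h)"
    and "B u = (h \<bullet> u) * (v \<bullet> v) - (v \<bullet> u) * (v \<bullet> h)" for u
  have expand: "K *\<^sub>R u = A u *\<^sub>R v + B u *\<^sub>R h + (u \<bullet> k) *\<^sub>R k" for u
    using cross3_expansion[of v h u] by (simp add: K_def k_def A_def B_def)
  \<comment> \<open>In these coordinates a plane through \<open>v\<close> becomes a line. For
    \<open>u \<bullet> k\<close> positive, \<open>u \<bullet> (w - v) \<le> 0\<close> is the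
    half-plane with intercept \<open>A u / (u \<bullet> k)\<close> and slope parameter
    \<open>B u / (u \<bullet> k)\<close>.\<close>
  have Kuw: "K * (u \<bullet> (w - v)) = - A u * Z w + B u * Y w + (u \<bullet> k) * X w" for u w
  proof -
    have "K * (u \<bullet> (w - v)) = (K *\<^sub>R u) \<bullet> (w - v)" by simp
    also have "\<dots> = A u * (v \<bullet> (w - v)) + B u * Y w + (u \<bullet> k) * X w"
      unfolding expand by (simp add: inner_add_left X_def Y_def)
    also have "v \<bullet> (w - v) = - Z w"
      using on_sphere[OF v] by (simp add: Z_def inner_diff_right)
    finally show ?thesis by simp
  qed
  have M: "v \<in> touching W u" "\<And>w. w \<in> W \<Longrightarrow> u \<bullet> (w - v) \<le> 0"
    "\<exists>w\<in>W-{v}. 0 < Y w \<and> u \<bullet> (w - v) = 0" "\<exists>w\<in>W-{v}. Y w < 0 \<and> u \<bullet> (w - v) = 0"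
    if "u \<in> facets_across v h" for u
  proof -
    have u: "u \<in> facet_normals W" "v \<in> touching W u"
      using that by (auto simp: facets_across_def)
    then show "v \<in> touching W u" "\<And>w. w \<in> W \<Longrightarrow> u \<bullet> (w - v) \<le> 0"
      using facet_normalsD(1)[OF u(1)] by (auto simp: touching_def inner_diff_right)
    show "\<exists>w\<in>W-{v}. 0 < Y w \<and> u \<bullet> (w - v) = 0" "\<exists>w\<in>W-{v}. Y w < 0 \<and> u \<bullet> (w - v) = 0"
      using that by (fastforce simp: facets_across_def touching_def Y_def inner_diff_right)+
  qed
  \<comment> \<open>With \<open>u \<bullet> k = 0\<close> the line would be parallel to the axis and
    yet contain points strictly on both sides of it; the equation then degenerates and
    \<open>u = 0\<close>.\<close>
  show nz: "u \<bullet> cross3 v h \<noteq> 0" if u: "u \<in> facets_across v h" for u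
  proof
    assume "u \<bullet> cross3 v h = 0"
    then have uk: "u \<bullet> k = 0" by (simp add: k_def)
    obtain w where w: "w \<in> W - {v}" "0 < Y w" "u \<bullet> (w - v) = 0" using M(3)[OF u] by blast
    obtain z where z: "z \<in> W - {v}" "Y z < 0" "u \<bullet> (z - v) = 0" using M(4)[OF u] by blast
    have eq: "B u * Y w = A u * Z w" "B u * Y z = A u * Z z"
      using Kuw[of u w] Kuw[of u z] w z uk by auto
    have "B u = 0"
    proof (rule ccontr)
      assume "B u \<noteq> 0"
      then consider "0 < B u" | "B u < 0" by linarith
      then show False
      proof cases
        case 1
        then have "0 < A u * Z w" "A u * Z z < 0"
          using eq w z by (metis mult_pos_pos, metis mult_pos_neg)
        then show False
          using Zpos[OF w(1)] Zpos[OF z(1)] by (simp add: zero_less_mult_iff mult_less_0_iff)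
      next
        case 2
        then have "A u * Z w < 0" "0 < A u * Z z"
          using eq w z by (metis mult_neg_pos, metis mult_neg_neg)
        then show False
          using Zpos[OF w(1)] Zpos[OF z(1)] by (simp add: zero_less_mult_iff mult_less_0_iff)
      qed
    qed
    moreover from this have "A u = 0" using eq Zpos[OF w(1)] by auto
    ultimately have "u = 0" using expand[of u] uk K by simp
    then show False using M(1)[OF u] by (auto simp: touching_def)
  qed
  have lp: "\<And>w. w \<in> W - {v} \<Longrightarrow> X w \<le> (A u / (u \<bullet> k)) * Z w - (B u / (u \<bullet> k)) * Y w"
    "\<exists>w\<in>W-{v}. 0 < Y w \<and> X w = (A u / (u \<bullet> k)) * Z w - (B u / (u \<bullet> k)) * Y w"
    "\<exists>w\<in>W-{v}. Y w < 0 \<and> X w = (A u / (u \<bullet> k)) * Z w - (B u / (u \<bullet> k)) * Y w"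
    if u: "u \<in> facets_across v h" "0 < u \<bullet> k" for u
  proof -
    have X: "X w = (A u / (u \<bullet> k)) * Z w - (B u / (u \<bullet> k)) * Y w + K * (u \<bullet> (w - v)) / (u \<bullet> k)"
        for w
      using u(2) by (simp add: Kuw field_simps)
    have "K * (u \<bullet> (w - v)) / (u \<bullet> k) \<le> 0" if "w \<in> W" for w
      using M(2)[OF u(1) that] K u(2) by (simp add: divide_nonpos_pos mult_nonneg_nonpos)
    then show "X w \<le> (A u / (u \<bullet> k)) * Z w - (B u / (u \<bullet> k)) * Y w" if "w \<in> W - {v}" for w
      using X[of w] that by auto
    show "\<exists>w\<in>W-{v}. 0 < Y w \<and> X w = (A u / (u \<bullet> k)) * Z w - (B u / (u \<bullet> k)) * Y w"
      "\<exists>w\<in>W-{v}. Y w < 0 \<and> X w = (A u / (u \<bullet> k)) * Z w - (B u / (u \<bullet> k)) * Y w"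
      using M(3,4)[OF u(1)] X by force+
  qed
  have unique: "u = u'" if u: "u \<in> facets_across v h" "0 < u \<bullet> k"
      and u': "u' \<in> facets_across v h" "0 < u' \<bullet> k" for u u'
  proof -
    define t m where "t = A u / (u \<bullet> k)" and "m = B u / (u \<bullet> k)"
    have nz: "u \<bullet> k \<noteq> 0" "u' \<bullet> k \<noteq> 0" using u u' by auto
    have eq: "t = A u' / (u' \<bullet> k) \<and> m = B u' / (u' \<bullet> k)"
      unfolding t_def m_def
      by (rule crossing_support_line_unique[of "W - {v}" Z X _ _ Y]) (use lp[OF u] lp[OF u'] Zpos
          in blast)+
    have "A u = (u \<bullet> k) * t" "B u = (u \<bullet> k) * m"
      using nz by (simp_all add: t_def m_def)
    moreover have "A u' = (u' \<bullet> k) * t" "B u' = (u' \<bullet> k) * m"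
      using nz by (simp_all add: conjunct1[OF eq] conjunct2[OF eq])
    ultimately have AB: "A u = (u \<bullet> k) * t" "B u = (u \<bullet> k) * m"
        "A u' = (u' \<bullet> k) * t" "B u' = (u' \<bullet> k) * m" .
    \<comment> \<open>Equal lines make both normals multiples of this one vector, and the level 1 at
      \<open>v\<close> fixes the factor.\<close>
    define N where "N = t *\<^sub>R v + m *\<^sub>R h + k"
    have uN: "K *\<^sub>R u = (u \<bullet> k) *\<^sub>R N" "K *\<^sub>R u' = (u' \<bullet> k) *\<^sub>R N"
      using expand[of u] expand[of u'] unfolding AB by (simp_all add: N_def algebra_simps)
    have "K *\<^sub>R u \<bullet> v = K" "K *\<^sub>R u' \<bullet> v = K"
      using M(1)[OF u(1)] M(1)[OF u'(1)] by (simp_all add: touching_def)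
    then have "(u \<bullet> k) * (N \<bullet> v) = K" "(u' \<bullet> k) * (N \<bullet> v) = K"
      unfolding uN by simp_all
    then have "u \<bullet> k = u' \<bullet> k"
      using K by (metis less_irrefl mult_cancel_right mult_zero_right)
    then have "K *\<^sub>R u = K *\<^sub>R u'" using uN by simp
    then show ?thesis using K by simp
  qed
  have ud: "\<exists>i\<in>W-{v}. 0 < Y i" "\<exists>i\<in>W-{v}. Y i < 0"
    using up down by (force simp: Y_def inner_diff_right)+
  obtain t m where tm: "\<And>w. w \<in> W-{v} \<Longrightarrow> X w \<le> t * Z w - m * Y w"
      "\<exists>w\<in>W-{v}. 0 < Y w \<and> X w = t * Z w - m * Y w" "\<exists>w\<in>W-{v}. Y w < 0 \<and> X w = t * Z w - m * Y w"
    by (rule crossing_support_line_exists[of "W - {v}" Z Y X, OF finite_Diff[OF finite_W] Zpos ud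
        Ynz])
      (assumption, assumption, (rule that; blast))
  define N where "N = k + m *\<^sub>R h + t *\<^sub>R v"
  have NX: "N \<bullet> (w - v) = X w + m * Y w - t * Z w" for w
  proof -
    have "v \<bullet> (w - v) = - Z w"
      using on_sphere[OF v] by (simp add: Z_def inner_diff_right)
    then show ?thesis
      by (simp add: N_def inner_add_left X_def Y_def)
  qed
  have Nle: "N \<bullet> w \<le> N \<bullet> v" if "w \<in> W" for w
  proof (cases "w = v")
    case False
    then show ?thesis using tm(1)[of w] that NX[of w] by (simp add: inner_diff_right)
  qed simp
  have Nk: "N \<bullet> k = K"
    using kv by (simp add: N_def inner_add_left inner_add_right K_def inner_commute)
  \<comment> \<open>The plane found must be scaled to level 1. A nonpositive level would bound all
    of \<open>W\<close>, and by symmetry \<open>N\<close> would vanish on \<open>W\<close>, which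
    spans the space.\<close>
  have "0 < N \<bullet> v"
  proof (rule ccontr)
    assume "\<not> 0 < N \<bullet> v"
    then have le0: "N \<bullet> w \<le> 0" if "w \<in> W" for w using Nle[OF that] by linarith
    have "N \<bullet> w = 0" if "w \<in> W" for w
      using le0[OF that] le0[OF uminus_W[OF that]] by simp
    then have "N = 0" by (rule spanning)
    with Nk K show False by simp
  qed
  define u where "u = (1 / (N \<bullet> v)) *\<^sub>R N"
  have uv: "u \<bullet> v = 1" "v \<in> touching W u" and ule: "\<And>w. w \<in> W \<Longrightarrow> u \<bullet> w \<le> 1"
    using \<open>0 < N \<bullet> v\<close> Nle v by (auto simp: u_def touching_def)
  have utouch: "w \<in> touching W u" if "w \<in> W" "X w = t * Z w - m * Y w" for w
    using that NX[of w] \<open>0 < N \<bullet> v\<close> by (simp add: touching_def u_def inner_diff_right)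
  obtain w where w: "w \<in> touching W u" "0 < Y w" using tm(2) utouch by blast
  obtain z where z: "z \<in> touching W u" "Y z < 0" using tm(3) utouch by blast
  have "Y v = 0" by (simp add: Y_def)
  then have "card {v, w, z} = 3" using w z by (auto simp: card_insert_if)
  moreover have "{v, w, z} \<subseteq> touching W u" using w z uv by auto
  ultimately have "3 \<le> card (touching W u)" using card_mono[OF finite_touching] by metis
  then have "u \<in> facets_across v h"
    using ule uv w z by (auto simp: facets_across_def facet_normals_def Y_def inner_diff_right)
  moreover have "0 < u \<bullet> k" using \<open>0 < N \<bullet> v\<close> Nk K by (simp add: u_def)
  ultimately have "{u \<in> facets_across v h. 0 < u \<bullet> cross3 v h} = {u}"
    using unique unfolding k_def by blast
  then show "\<exists>u. {u \<in> facets_across v h. 0 < u \<bullet> cross3 v h} = {u}" ..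
qed

text \<open>Replacing \<open>h\<close> by \<open>- h\<close> keeps the facets and exchanges the two
  sides, so each side contributes exactly one facet.\<close>

lemma card_facets_across:
  assumes "v \<in> W" and "inj_on (\<lambda>w. h \<bullet> w) W"
    and "\<exists>w\<in>W. h \<bullet> v < h \<bullet> w" and "\<exists>z\<in>W. h \<bullet> z < h \<bullet> v"
  shows "card (facets_across v h) = 2"
proof -
  obtain u where u: "{u \<in> facets_across v h. 0 < u \<bullet> cross3 v h} = {u}"
    using facets_across_side(1)[OF assms] by blast
  have "inj_on (\<lambda>w. (- h) \<bullet> w) W" using assms(2) by (auto simp: inj_on_def)
  then obtain u' where u': "{u \<in> facets_across v (- h). 0 < u \<bullet> cross3 v (- h)} = {u'}"
    using facets_across_side(1)[of v "- h"] assms by auto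
  have neg: "facets_across v (- h) = facets_across v h"
    by (auto simp: facets_across_def)
  have "facets_across v h = {u \<in> facets_across v h. 0 < u \<bullet> cross3 v h}
      \<union> {u \<in> facets_across v (- h). 0 < u \<bullet> cross3 v (- h)}"
    using facets_across_side(2)[OF assms] by (auto simp: neg not_less order.order_iff_strict)
  then have eq: "facets_across v h = {u, u'}" unfolding u u' by auto
  moreover have "0 < u \<bullet> cross3 v h" "u' \<bullet> cross3 v h < 0"
    using u u' by auto
  then have "u \<noteq> u'" by auto
  ultimately show ?thesis by simp
qed

text \<open>This is Euler's formula: the sum counts the triangles in a triangulation of the boundary.\<close>

lemma sum_facets:
  "(\<Sum>u\<in>facet_normals W. card (touching W u) - 2) = 2 * (card W - 2)"
proof -
  obtain h :: "real^3" where h: "inj_on (\<lambda>w. h \<bullet> w) W"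
    using exists_injective_functional[OF finite_W] .
  define mid where "mid S v \<longleftrightarrow> (\<exists>w\<in>S. h \<bullet> v < h \<bullet> w) \<and> (\<exists>z\<in>S. h \<bullet> z < h \<bullet> v)" for S v
  have mid: "card {v\<in>S. mid S v} = card S - 2" if "S \<subseteq> W" "2 \<le> card S" for S
    unfolding mid_def
    using card_strictly_between[of S "\<lambda>w. h \<bullet> w"] that finite_W h
    by (meson finite_subset inj_on_subset)
  have "(\<Sum>u\<in>facet_normals W. card (touching W u) - 2) =
      (\<Sum>u\<in>facet_normals W. card {v\<in>W. v \<in> touching W u \<and> mid (touching W u) v})"
  proof (intro sum.cong refl)
    fix u assume "u \<in> facet_normals W"
    then have "card (touching W u) - 2 = card {v\<in>touching W u. mid (touching W u) v}"
      using mid[OF touching_subset, of u] facet_normalsD(2)[of u] by simp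
    also have "{v\<in>touching W u. mid (touching W u) v} = {v\<in>W. v \<in> touching W u
        \<and> mid (touching W u) v}"
      by (auto simp: touching_def)
    finally show "card (touching W u) - 2 = card {v\<in>W. v \<in> touching W u \<and> mid (touching W u) v}" .
  qed
  also have "\<dots> = (\<Sum>v\<in>W. card {u\<in>facet_normals W. v \<in> touching W u \<and> mid (touching W u) v})"
    by (rule sum_card_swap[OF finite_facet_normals finite_W])
  \<comment> \<open>The highest and the lowest point of \<open>W\<close> are strictly intermediate
    in no facet, every other point in two.\<close>
  also have "\<dots> = (\<Sum>v\<in>W. if mid W v then 2 else 0)"
  proof (intro sum.cong refl)
    fix v assume v: "v \<in> W"
    have eq: "{u\<in>facet_normals W. v \<in> touching W u \<and> mid (touching W u) v} = facets_across v h"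
      by (auto simp: facets_across_def mid_def)
    show "card {u\<in>facet_normals W. v \<in> touching W u \<and> mid (touching W u) v}
        = (if mid W v then 2 else 0)"
    proof (cases "mid W v")
      case True
      then show ?thesis
        unfolding eq using card_facets_across[OF v h] by (simp add: mid_def)
    next
      case False
      then have "facets_across v h = {}"
        by (auto simp: facets_across_def mid_def touching_def)
      then show ?thesis unfolding eq using False by simp
    qed
  qed
  also have "\<dots> = 2 * card {v\<in>W. mid W v}"
    using finite_W by (simp add: sum.If_cases Int_def)
  also have "\<dots> = 2 * (card W - 2)"
    using mid[OF order_refl card_W_ge_2] by simp
  finally show ?thesis .
qed

section \<open>Nonacute face angles around a vertex\<close>

definition nonacute_facets :: "real^3 \<Rightarrow> (real^3) set" where
  "nonacute_facets v = {u \<in> facet_normals W. v \<in> touching W u \<and>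
    (\<exists>p\<in>touching W u - {v}. \<exists>r\<in>touching W u - {v}. (p - v) \<bullet> (r - v) \<le> 0)}"

text \<open>Projecting along \<open>v\<close> to the plane orthogonal to \<open>v\<close> turns the nonacute angles at \<open>v\<close> into
    obtuse
  angular sectors with disjoint interiors. Each of them contains one of the four directions
  \<open>x, -x, j, -j\<close> of an orthogonal frame in its interior,
      and \<open>x\<close> is chosen on the boundary of the first
  sector. That \<open>d\<close> lies in the interior of the sector of \<open>u\<close> is expressed by \<open>u\<close> being the unique
  maximiser of \<open>u' \<bullet> d\<close> among all facets at \<open>v\<close>.\<close>

lemma card_nonacute_facets_le:
  assumes v: "v \<in> W"
  shows "card (nonacute_facets v) \<le> 3"
proof (cases "nonacute_facets v = {}")
  case False
  then obtain u1 p1 r1 where u1: "u1 \<in> facet_normals W" "v \<in> touching W u1"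
    and p1: "p1 \<in> touching W u1" "p1 \<noteq> v" and r1: "r1 \<in> touching W u1" "r1 \<noteq> v"
    and angle1: "(p1 - v) \<bullet> (r1 - v) \<le> 0"
    by (auto simp: nonacute_facets_def)
  have vv: "v \<bullet> v = q" by (rule on_sphere[OF v])
  have down: "(p - v) \<bullet> v < 0" if "p \<in> W" "p \<noteq> v" for p
    using inner_less_q[OF that(1) v that(2)] vv by (simp add: inner_diff_left)
  define e where "e = p1 - v"
  \<comment> \<open>Up to the factor \<open>q\<close>, which avoids a division, this is the
    component of the edge vector \<open>e\<close> orthogonal to \<open>v\<close>.\<close>
  define x where "x = q *\<^sub>R e - (e \<bullet> v) *\<^sub>R v"
  define j where "j = cross3 v x"
  define K where "K = q * (x \<bullet> x)"
  have xv: "x \<bullet> v = 0" by (simp add: x_def inner_diff_left vv)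
  have "x \<noteq> 0"
  proof
    assume "x = 0"
    then have "q *\<^sub>R e = (e \<bullet> v) *\<^sub>R v" by (simp add: x_def)
    then have "u1 \<bullet> (q *\<^sub>R e) = u1 \<bullet> ((e \<bullet> v) *\<^sub>R v)" by simp
    then have "e \<bullet> v = 0"
      using p1 u1 by (simp add: e_def touching_def inner_diff_right)
    then show False using down[of p1] p1 by (auto simp: e_def touching_def)
  qed
  then have K: "0 < K" "0 < x \<bullet> x" using q_pos by (auto simp: K_def)
  have jj: "j \<bullet> j = K"
    using norm_cross_dot[of v x] xv vv
    by (simp add: j_def K_def power2_norm_eq_inner power_mult_distrib inner_commute)
  have jv: "j \<bullet> v = 0" "j \<bullet> x = 0"
    by (simp_all add: j_def dot_cross_self inner_commute)
  have expand: "K *\<^sub>R p = ((p \<bullet> v) * (x \<bullet> x)) *\<^sub>R v + (q * (p \<bullet> x)) *\<^sub>R x + (p \<bullet> j) *\<^sub>R j" for p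
    using cross3_expansion[of v x p] jj xv vv by (simp add: j_def inner_commute mult.commute)
  have dot: "K * (a \<bullet> b) = (a \<bullet> v) * (b \<bullet> v) * (x \<bullet> x) + q * ((a \<bullet> x) * (b \<bullet> x))
      + (a \<bullet> j) * (b \<bullet> j)" for a b
  proof -
    have "K * (a \<bullet> b) = (K *\<^sub>R a) \<bullet> b" by simp
    also have "\<dots> = (a \<bullet> v) * (b \<bullet> v) * (x \<bullet> x) + q * ((a \<bullet> x) * (b \<bullet> x)) + (a \<bullet> j) * (b \<bullet> j)"
      unfolding expand by (simp add: inner_add_left inner_add_right inner_commute)
    finally show ?thesis .
  qed
  define smax where "smax u d \<longleftrightarrow> (\<forall>w\<in>facet_normals W. v \<in> touching W w \<longrightarrow> w \<noteq> u \<longrightarrow> w \<bullet> d < u \<bullet> d)"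
      for u d
  \<comment> \<open>All facets at \<open>v\<close> take the value 1 at \<open>v\<close>, so the
    \<open>v\<close>-component of \<open>s\<close> does not affect the comparison; the sign of
    \<open>\<delta>\<close> decides between \<open>d\<close> and \<open>- d\<close>.\<close>
  have smaxI: "smax u d \<or> smax u (- d)"
    if Ks: "K *\<^sub>R s = \<gamma> *\<^sub>R v + \<delta> *\<^sub>R d" and "\<delta> \<noteq> 0" "v \<in> touching W u" "u \<bullet> s = 0"
      and neg: "\<And>w. w \<in> facet_normals W \<Longrightarrow> v \<in> touching W w \<Longrightarrow> w \<noteq> u \<Longrightarrow> w \<bullet> s < 0" for u s d \<gamma> \<delta>
  proof -
    have eq: "K * (w \<bullet> s) = \<gamma> + \<delta> * (w \<bullet> d)" if "v \<in> touching W w" for w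
      using arg_cong[OF Ks, of "\<lambda>y. w \<bullet> y"] that by (simp add: inner_add_right touching_def)
    have lt: "\<delta> * (w \<bullet> d) < \<delta> * (u \<bullet> d)" if "w \<in> facet_normals W" "v \<in> touching W w" "w \<noteq> u" for w
      using eq[OF that(2)] eq[OF \<open>v \<in> touching W u\<close>] \<open>u \<bullet> s = 0\<close> K mult_pos_neg[of K "w \<bullet> s"]
        neg[OF that] by simp
    show ?thesis
    proof (cases "0 < \<delta>")
      case True
      then have "smax u d" using lt by (auto simp: smax_def)
      then show ?thesis ..
    next
      case False
      then have "smax u (- d)" using lt \<open>\<delta> \<noteq> 0\<close> by (auto simp: smax_def mult_less_cancel_left)
      then show ?thesis ..
    qed
  qed
  \<comment> \<open>Both edge vectors have negative \<open>v\<close>-coordinate, so a nonpositive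
    inner product forces opposite signs of their \<open>x\<close>-coordinates or of their
    \<open>j\<close>-coordinates. A positive combination cancelling such a coordinate lies inside
    the sector and projects to the other axis.\<close>
  have dir: "((p - v) \<bullet> x * ((r - v) \<bullet> x) < 0 \<longrightarrow> smax u j \<or> smax u (- j)) \<and>
      ((p - v) \<bullet> j * ((r - v) \<bullet> j) < 0 \<longrightarrow> smax u x \<or> smax u (- x)) \<and>
      ((p - v) \<bullet> x * ((r - v) \<bullet> x) < 0 \<or> (p - v) \<bullet> j * ((r - v) \<bullet> j) < 0)"
    if u: "u \<in> facet_normals W" "v \<in> touching W u" and p: "p \<in> touching W u" "p \<noteq> v"
      and r: "r \<in> touching W u" "r \<noteq> v" and angle: "(p - v) \<bullet> (r - v) \<le> 0" for u p r
  proof -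
    have pd: "(p - v) \<bullet> v < 0" and rd: "(r - v) \<bullet> v < 0"
      using down p r by (auto simp: touching_def)
    have "0 < (r - v) \<bullet> (r - v)" using r by simp
    then have "p \<noteq> r" using angle by (metis not_less)
    have comb: "u \<bullet> s = 0" "s \<bullet> v < 0" "\<And>w. w \<in> facet_normals W \<Longrightarrow> v \<in> touching W w \<Longrightarrow> w \<noteq> u
        \<Longrightarrow> w \<bullet> s < 0"
      if s: "s = \<alpha> *\<^sub>R (p - v) + \<beta> *\<^sub>R (r - v)" and pos: "0 < \<alpha>" "0 < \<beta>" for s \<alpha> \<beta>
    proof -
      show "u \<bullet> s = 0"
        using u p r by (simp add: s inner_add_right inner_diff_right touching_def)
      show "s \<bullet> v < 0"
        using mult_pos_neg[OF pos(1) pd] mult_pos_neg[OF pos(2) rd] by (simp add: s inner_add_left)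
      fix w assume w: "w \<in> facet_normals W" "v \<in> touching W w" "w \<noteq> u"
      have "w \<bullet> (p - v) \<le> 0" "w \<bullet> (r - v) \<le> 0"
        using facet_normalsD(1)[OF w(1)] w(2) p r by (auto simp: inner_diff_right touching_def)
      moreover have "\<not> (w \<bullet> (p - v) = 0 \<and> w \<bullet> (r - v) = 0)"
      proof
        assume "w \<bullet> (p - v) = 0 \<and> w \<bullet> (r - v) = 0"
        then have "{v, p, r} \<subseteq> touching W w" "{v, p, r} \<subseteq> touching W u"
          using w u p r by (auto simp: touching_def inner_diff_right)
        then show False using normal_eqI[of v p r w u] p r \<open>p \<noteq> r\<close> w by auto
      qed
      ultimately have "w \<bullet> (p - v) < 0 \<and> w \<bullet> (r - v) \<le> 0 \<or> w \<bullet> (p - v) \<le> 0 \<and> w \<bullet> (r - v) < 0"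
        by linarith
      then show "w \<bullet> s < 0"
        using mult_pos_neg[OF pos(1), of "w \<bullet> (p - v)"] mult_pos_neg[OF pos(2), of "w \<bullet> (r - v)"]
          mult_nonneg_nonpos[of \<alpha> "w \<bullet> (p - v)"] mult_nonneg_nonpos[of \<beta> "w \<bullet> (r - v)"] pos
        by (auto simp: s inner_add_right)
    qed
    have balance: "\<exists>\<alpha> \<beta>. 0 < \<alpha> \<and> 0 < \<beta> \<and> \<alpha> * a + \<beta> * b = 0" if "a * b < 0" for a b :: real
    proof -
      have "\<bar>b\<bar> * a + \<bar>a\<bar> * b = 0" "0 < \<bar>b\<bar>" "0 < \<bar>a\<bar>"
        using that by (auto simp: mult_less_0_iff abs_if)
      then show ?thesis by blast
    qed
    have 1: "smax u j \<or> smax u (- j)" if neg: "(p - v) \<bullet> x * ((r - v) \<bullet> x) < 0"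
    proof -
      obtain \<alpha> \<beta> where ab: "0 < \<alpha>" "0 < \<beta>" "\<alpha> * ((p - v) \<bullet> x) + \<beta> * ((r - v) \<bullet> x) = 0"
        using balance[OF neg] by blast
      define s where "s = \<alpha> *\<^sub>R (p - v) + \<beta> *\<^sub>R (r - v)"
      have "s \<bullet> x = 0" using ab by (simp add: s_def inner_add_left)
      then have Ks: "K *\<^sub>R s = ((s \<bullet> v) * (x \<bullet> x)) *\<^sub>R v + (s \<bullet> j) *\<^sub>R j"
        using expand[of s] by simp
      \<comment> \<open>Otherwise \<open>s\<close> would be a nonzero multiple of \<open>v\<close>,
        where \<open>u\<close> cannot vanish.\<close>
      moreover have "s \<bullet> j \<noteq> 0"
      proof
        assume "s \<bullet> j = 0"
        then have "K *\<^sub>R s = ((s \<bullet> v) * (x \<bullet> x)) *\<^sub>R v" using Ks by simp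
        then have "u \<bullet> (K *\<^sub>R s) = (s \<bullet> v) * (x \<bullet> x)"
          using u(2) by (simp add: touching_def)
        then show False using comb(1,2)[OF s_def ab(1,2)] K(2) by simp
      qed
      ultimately show ?thesis
        using smaxI comb[OF s_def ab(1,2)] u(2) by blast
    qed
    have 2: "smax u x \<or> smax u (- x)" if neg: "(p - v) \<bullet> j * ((r - v) \<bullet> j) < 0"
    proof -
      obtain \<alpha> \<beta> where ab: "0 < \<alpha>" "0 < \<beta>" "\<alpha> * ((p - v) \<bullet> j) + \<beta> * ((r - v) \<bullet> j) = 0"
        using balance[OF neg] by blast
      define s where "s = \<alpha> *\<^sub>R (p - v) + \<beta> *\<^sub>R (r - v)"
      have "s \<bullet> j = 0" using ab by (simp add: s_def inner_add_left)
      then have Ks: "K *\<^sub>R s = ((s \<bullet> v) * (x \<bullet> x)) *\<^sub>R v + (q * (s \<bullet> x)) *\<^sub>R x"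
        using expand[of s] by simp
      moreover have "q * (s \<bullet> x) \<noteq> 0"
      proof
        assume "q * (s \<bullet> x) = 0"
        then have "K *\<^sub>R s = ((s \<bullet> v) * (x \<bullet> x)) *\<^sub>R v" using Ks by simp
        then have "u \<bullet> (K *\<^sub>R s) = (s \<bullet> v) * (x \<bullet> x)"
          using u(2) by (simp add: touching_def)
        then show False using comb(1,2)[OF s_def ab(1,2)] K(2) by simp
      qed
      ultimately show ?thesis
        using smaxI comb[OF s_def ab(1,2)] u(2) by blast
    qed
    have "((p - v) \<bullet> v) * ((r - v) \<bullet> v) * (x \<bullet> x) + q * ((p - v) \<bullet> x * ((r - v) \<bullet> x))
        + (p - v) \<bullet> j * ((r - v) \<bullet> j) \<le> 0"
      using dot[of "p - v" "r - v"] mult_nonneg_nonpos[OF less_imp_le[OF K(1)] angle] by simp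
    moreover have "0 < ((p - v) \<bullet> v) * ((r - v) \<bullet> v) * (x \<bullet> x)"
      using pd rd K(2) by (simp add: mult_neg_neg)
    ultimately have "q * ((p - v) \<bullet> x * ((r - v) \<bullet> x)) < 0 \<or> (p - v) \<bullet> j * ((r - v) \<bullet> j) < 0"
      by linarith
    then have "(p - v) \<bullet> x * ((r - v) \<bullet> x) < 0 \<or> (p - v) \<bullet> j * ((r - v) \<bullet> j) < 0"
      using q_pos mult_nonneg_nonneg[of q "(p - v) \<bullet> x * ((r - v) \<bullet> x)"] by linarith
    with 1 2 show ?thesis by blast
  qed
  \<comment> \<open>The first edge projects onto the \<open>x\<close>-axis, so its
    \<open>j\<close>-coordinate vanishes and the first sector must contain \<open>j\<close> or
    \<open>- j\<close>.\<close>
  have "q * (e \<bullet> j) = 0"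
  proof -
    have "q *\<^sub>R e = x + (e \<bullet> v) *\<^sub>R v" by (simp add: x_def)
    then have "(q *\<^sub>R e) \<bullet> j = 0" using jv by (simp add: inner_add_left inner_add_right
        inner_commute)
    then show ?thesis by simp
  qed
  then have "(p1 - v) \<bullet> j = 0" using q_pos by (simp add: e_def)
  then have first: "smax u1 j \<or> smax u1 (- j)"
    using dir[OF u1 p1 r1 angle1] by simp
  \<comment> \<open>Since \<open>x\<close> bounds the first sector, \<open>u1\<close> already
    attains the maximum on \<open>x\<close>, and no other facet is a strict maximiser there. Only
    three directions remain for all nonacute facets.\<close>
  have weak: "w \<bullet> x \<le> u1 \<bullet> x" if "w \<in> facet_normals W" "v \<in> touching W w" for w
  proof -
    have "w \<bullet> p1 \<le> 1" using facet_normalsD(1)[OF that(1)] p1 by (auto simp: touching_def)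
    then have "w \<bullet> e \<le> u1 \<bullet> e"
      using that(2) u1 p1 by (simp add: e_def inner_diff_right touching_def)
    then show ?thesis
      using that(2) u1 q_pos by (simp add: x_def inner_diff_right touching_def)
  qed
  have ex: "\<exists>d\<in>{- x, j, - j}. smax u d" if u: "u \<in> nonacute_facets v" for u
  proof (cases "u = u1")
    case True
    then show ?thesis using first by blast
  next
    case False
    obtain p r where pr: "u \<in> facet_normals W" "v \<in> touching W u" "p \<in> touching W u" "p \<noteq> v"
        "r \<in> touching W u" "r \<noteq> v" "(p - v) \<bullet> (r - v) \<le> 0"
      using u by (auto simp: nonacute_facets_def)
    have "\<not> smax u x"
      using weak[OF pr(1,2)] u1 False by (force simp: smax_def)
    then show ?thesis using dir[OF pr] by blast
  qed
  define f where "f u = (SOME d. d \<in> {- x, j, - j} \<and> smax u d)" for u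
  have f: "f u \<in> {- x, j, - j}" "smax u (f u)" if "u \<in> nonacute_facets v" for u
    using someI_ex[of "\<lambda>d. d \<in> {- x, j, - j} \<and> smax u d"] ex[OF that] unfolding f_def by blast+
  have "inj_on f (nonacute_facets v)"
  proof (rule inj_onI, rule ccontr)
    fix u w assume *: "u \<in> nonacute_facets v" "w \<in> nonacute_facets v" "f u = f w" "u \<noteq> w"
    then have "w \<bullet> f u < u \<bullet> f u" "u \<bullet> f u < w \<bullet> f u"
      using f(2)[OF *(1)] f(2)[OF *(2)] by (auto simp: smax_def nonacute_facets_def)
    then show False by simp
  qed
  then have "card (nonacute_facets v) \<le> card {- x, j, - j}"
    using f(1) by (intro card_inj_on_le[of f]) auto
  also have "\<dots> \<le> 3" by (simp add: card_insert_if)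
  finally show ?thesis .
qed simp

end

section \<open>Counting Gabriel pairs\<close>

context spanning_sphere_set
begin

text \<open>The point of the sphere diametrically opposite to \<open>x\<close> on the circle cut out by the plane
  \<open>{w. u \<bullet> w = 1}\<close>.\<close>

definition partner :: "real^3 \<Rightarrow> real^3 \<Rightarrow> real^3" where
  "partner u x = (2 / (u \<bullet> u)) *\<^sub>R u - x"

text \<open>Four points on a circle closed under passing to the diametrically opposite point form a
  rectangle; \<open>is_rectangle_hull_iff\<close> proves the agreement with the geometric
  notion.\<close>

definition rect_facet :: "real^3 \<Rightarrow> bool" where
  "rect_facet u \<longleftrightarrow> card (touching W u) = 4 \<and> (\<forall>x\<in>touching W u. partner u x \<in> touching W u)"

text \<open>Gabriel pairs are sorted by the number of facets through them: a pair that is an edge as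
  well as a diameter counts as a side. So a side belongs to two facets and a diameter to
  one.\<close>

definition sides :: "real^3 \<Rightarrow> ((real^3) \<times> (real^3)) set" where
  "sides u = {(x, y) \<in> gabriel_pairs W. u \<in> facets_through x y \<and> card (facets_through x y) = 2}"

definition diameters :: "real^3 \<Rightarrow> ((real^3) \<times> (real^3)) set" where
  "diameters u = {(x, y) \<in> gabriel_pairs W. u \<in> facets_through x y \<and> card (facets_through x y) = 1}"

definition rects :: "real^3 \<Rightarrow> (real^3) set" where
  "rects v = {u \<in> facet_normals W. v \<in> touching W u \<and> rect_facet u}"

lemma finite_sides: "finite (sides u)" and finite_diameters: "finite (diameters u)"
  by (rule finite_subset[OF _ finite_gabriel], auto simp: sides_def diameters_def)+

lemma partner_partner: "partner u (partner u x) = x"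
  by (simp add: partner_def)

lemma partner_sum:
  assumes "x \<in> touching W u" "partner u x \<in> touching W u"
  shows "x + partner u x = (q + x \<bullet> partner u x) *\<^sub>R u"
proof -
  have s: "x + partner u x = (2 / (u \<bullet> u)) *\<^sub>R u" by (simp add: partner_def)
  have "(x + partner u x) \<bullet> x = 2 / (u \<bullet> u)"
    unfolding s using assms by (simp add: touching_def)
  moreover have "(x + partner u x) \<bullet> x = q + x \<bullet> partner u x"
    using assms on_sphere by (simp add: touching_def inner_simps inner_commute)
  ultimately have "2 / (u \<bullet> u) = q + x \<bullet> partner u x" by (rule trans[OF sym])
  with s show ?thesis by metis
qed

lemma partner_neq:
  assumes "u \<in> facet_normals W" "x \<in> touching W u" "partner u x \<in> touching W u"
  shows "partner u x \<noteq> x"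
proof
  assume "partner u x = x"
  then have s: "x + x = (q + q) *\<^sub>R u"
    using partner_sum[OF assms(2,3)] on_sphere assms(2) by (simp add: touching_def)
  have "x = q *\<^sub>R u"
    using s by (simp add: scaleR_left_distrib vec_eq_iff)
  obtain z where z: "z \<in> touching W u" "z \<noteq> x"
    using card_ge_3E[OF facet_normalsD(2)[OF assms(1)]] by metis
  have "x \<bullet> z = q" using z unfolding \<open>x = q *\<^sub>R u\<close> by (simp add: touching_def)
  then show False using inner_less_q[of x z] z assms by (auto simp: touching_def)
qed

text \<open>Thales' theorem on the circumcircle of the face.\<close>

lemma partner_right_angle:
  assumes "x \<in> touching W u" "partner u x \<in> touching W u" "z \<in> touching W u"
  shows "(x - z) \<bullet> (partner u x - z) = 0"
proof -
  have "(x - z) \<bullet> (partner u x - z) = x \<bullet> partner u x - (x + partner u x) \<bullet> z + z \<bullet> z"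
    by (simp add: inner_simps inner_commute)
  also have "(x + partner u x) \<bullet> z = q + x \<bullet> partner u x"
    unfolding partner_sum[OF assms(1,2)] using assms by (simp add: touching_def)
  finally show ?thesis using on_sphere[of z] assms by (simp add: touching_def)
qed

lemma partner_gabriel_normal:
  assumes "x \<in> W" "y \<in> W" "x \<noteq> - y"
  shows "partner ((1 / (q + x \<bullet> y)) *\<^sub>R (x + y)) x = y"
proof -
  define s where "s = q + x \<bullet> y"
  have "0 < s" using inner_greater_minus_q[OF assms] by (simp add: s_def)
  moreover have "(x + y) \<bullet> (x + y) = 2 * s"
    using assms on_sphere by (simp add: s_def inner_simps inner_commute)
  ultimately show ?thesis
    unfolding s_def[symmetric] by (simp add: partner_def)
qed

lemma diameters_partner:
  assumes "(x, y) \<in> diameters u"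
  shows "y = partner u x" "x \<in> touching W u" "y \<in> touching W u" "u \<in> facet_normals W"
proof -
  have xy: "(x, y) \<in> gabriel_pairs W" "u \<in> facets_through x y" "card (facets_through x y) = 1"
    using assms by (auto simp: diameters_def)
  then have "u = (1 / (q + x \<bullet> y)) *\<^sub>R (x + y)"
    using gabriel_facets_through[OF xy(1)] by auto
  then show "y = partner u x"
    using partner_gabriel_normal[of x y] xy(1) by (simp add: gabriel_pairs_def)
  show "x \<in> touching W u" "y \<in> touching W u" "u \<in> facet_normals W"
    using xy(2) by (auto simp: facets_through_def)
qed

lemma inj_on_fst_diameters: "inj_on fst (diameters u)"
proof (rule inj_onI)
  fix a b assume "a \<in> diameters u" "b \<in> diameters u" "fst a = fst b"
  then show "a = b"
    using diameters_partner(1)[of "fst a" "snd a" u] diameters_partner(1)[of "fst b" "snd b" u]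
    by (metis prod.collapse)
qed

lemma fst_diameters_subset: "fst ` diameters u \<subseteq> touching W u"
  by (auto dest: diameters_partner(2))

lemma card_diameters_le: "card (diameters u) \<le> card (touching W u)"
  using card_inj_on_le[OF inj_on_fst_diameters fst_diameters_subset finite_touching] .

lemma even_card_diameters: "even (card (diameters u))"
proof (rule even_card_involution[of _ prod.swap])
  show "prod.swap g \<in> diameters u" if "g \<in> diameters u" for g
    using that by (auto simp: diameters_def facets_through_commute intro: gabriel_pairs_sym)
  show "prod.swap g \<noteq> g" if "g \<in> diameters u" for g
    using that by (auto simp: diameters_def gabriel_pairs_def)
qed (auto simp: finite_diameters)

lemma card_sides_le:
  assumes "u \<in> facet_normals W"
  shows "card (sides u) \<le> 2 * card (touching W u)"
proof -
  define nb where "nb x = {y \<in> touching W u. y \<noteq> x \<and> card (facets_through x y) = 2}" for x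
  have "sides u \<subseteq> Sigma (touching W u) nb"
    by (auto simp: sides_def nb_def facets_through_def gabriel_pairs_def)
  then have "card (sides u) \<le> card (Sigma (touching W u) nb)"
    using finite_touching by (intro card_mono finite_SigmaI) (auto simp: nb_def)
  also have "\<dots> = (\<Sum>x\<in>touching W u. card (nb x))"
    using finite_touching by (intro card_SigmaI) (auto simp: nb_def)
  also have "\<dots> \<le> (\<Sum>x\<in>touching W u. 2)"
    using card_neighbours_in_facet[OF assms] by (intro sum_mono) (simp add: nb_def)
  finally show ?thesis by simp
qed

lemma cross3_inner_zero: "cross3 x y \<bullet> x = 0" "cross3 x y \<bullet> y = 0"
  by (simp_all add: dot_cross_self inner_commute)

text \<open>If \<open>cross3 x y\<close> is constant on the other vertices, they lie on one side, so
  the pair is an edge. This serves triangles, with one other vertex, and rectangles, whose opposite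
  side is parallel.\<close>

lemma two_facets_through_cross3:
  assumes u: "u \<in> facet_normals W" and xy: "x \<in> touching W u" "y \<in> touching W u" "x \<noteq> y"
    and same: "\<And>w. w \<in> touching W u \<Longrightarrow> w \<noteq> x \<Longrightarrow> w \<noteq> y \<Longrightarrow> cross3 x y \<bullet> w = c"
  shows "card (facets_through x y) = 2"
proof (cases "c \<le> 0")
  case True
  have "cross3 x y \<bullet> w \<le> 0" if "w \<in> touching W u" for w
    using same[OF that] True cross3_inner_zero[of x y] by (cases "w = x \<or> w = y") auto
  then show ?thesis
    using two_facets_through[OF u xy cross3_touching_nonzero[OF xy] cross3_inner_zero] by blast
next
  case False
  have "- cross3 x y \<bullet> w \<le> 0" if "w \<in> touching W u" for w
    using same[OF that] False cross3_inner_zero[of x y] by (cases "w = x \<or> w = y") auto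
  then show ?thesis
    using two_facets_through[OF u xy, of "- cross3 x y"] cross3_touching_nonzero[OF xy]
        cross3_inner_zero[of x y]
    by simp
qed

lemma triangle_facets_through:
  assumes "u \<in> facet_normals W" "card (touching W u) = 3"
      and xy: "x \<in> touching W u" "y \<in> touching W u" "x \<noteq> y"
  shows "card (facets_through x y) = 2"
proof -
  obtain z where z: "z \<in> touching W u" "z \<noteq> x" "z \<noteq> y"
    using card_ge_3E[of "touching W u"] assms(2) by (metis order_refl)
  then have "card {x, y, z} = card (touching W u)"
    using xy assms(2) by auto
  then have "{x, y, z} = touching W u"
    using z xy by (intro card_subset_eq finite_touching) auto
  then have "cross3 x y \<bullet> w = cross3 x y \<bullet> z" if "w \<in> touching W u" "w \<noteq> x" "w \<noteq> y" for w
    using that by auto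
  then show ?thesis
    using two_facets_through_cross3[OF assms(1) xy] by blast
qed

lemma rect_facet_cases:
  assumes "rect_facet u" "u \<in> facet_normals W" "x \<in> touching W u" "y \<in> touching W u" "y \<noteq> x" "y \<noteq>
      partner u x"
  shows "touching W u = {x, partner u x, y, partner u y}"
    "distinct [x, partner u x, y, partner u y]" "x + partner u x = y + partner u y"
proof -
  have p: "partner u x \<in> touching W u" "partner u y \<in> touching W u"
    using assms by (auto simp: rect_facet_def)
  show s: "x + partner u x = y + partner u y" by (simp add: partner_def)
  show d: "distinct [x, partner u x, y, partner u y]"
    using partner_neq[OF assms(2,3) p(1)] partner_neq[OF assms(2,4) p(2)] assms(5,6) s
    by (auto simp: add.commute)
  have "card {x, partner u x, y, partner u y} = card (touching W u)"
    using distinct_card[OF d] assms(1) by (simp add: rect_facet_def)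
  then show "touching W u = {x, partner u x, y, partner u y}"
    using p assms by (intro card_subset_eq[symmetric] finite_touching) auto
qed

lemma rects_subset_nonacute: "rects v \<subseteq> nonacute_facets v"
proof
  fix u assume "u \<in> rects v"
  then have u: "u \<in> facet_normals W" "v \<in> touching W u" "rect_facet u" by (auto simp: rects_def)
  obtain p where p: "p \<in> touching W u" "p \<noteq> v" "p \<noteq> partner u v"
    using card_ge_3E[OF facet_normalsD(2)[OF u(1)]] by metis
  then have r: "partner u p \<in> touching W u" "partner u p \<noteq> v"
    using u partner_partner[of u p] by (auto simp: rect_facet_def)
  have "(p - v) \<bullet> (partner u p - v) \<le> 0"
    using partner_right_angle[OF p(1) r(1) u(2)] by simp
  then have "\<exists>p\<in>touching W u - {v}. \<exists>r\<in>touching W u - {v}. (p - v) \<bullet> (r - v) \<le> 0"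
    using p r by blast
  then show "u \<in> nonacute_facets v"
    using u by (simp add: nonacute_facets_def)
qed

lemma finite_nonacute_facets: "finite (nonacute_facets v)"
  using finite_facet_normals by (simp add: nonacute_facets_def)

lemma card_rects_le: "v \<in> W \<Longrightarrow> card (rects v) \<le> 3"
  using card_mono[OF finite_nonacute_facets rects_subset_nonacute] card_nonacute_facets_le
      order.trans by blast

text \<open>Diameters get weight 2 because they occur in one facet only. Among ordered pairs a face
  with \<open>k\<close> vertices has at most \<open>2 * k\<close> sides and at most \<open>k\<close>
  diameters. A triangle has no diameters; for \<open>k = 5\<close> parity lowers their number to
  \<open>4\<close>; for \<open>k = 4\<close> more than two of them means that both diagonals are
  diameters, and then the count exceeds \<open>6 * k - 12\<close> by at most
  \<open>4\<close>.\<close>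

lemma facet_bound:
  assumes u: "u \<in> facet_normals W"
  shows "card (sides u) + 2 * card (diameters u) + 12
    \<le> 6 * card (touching W u) + (if rect_facet u then 4 else 0)"
proof -
  have k3: "3 \<le> card (touching W u)" by (rule facet_normalsD(2)[OF u])
  have s: "card (sides u) \<le> 2 * card (touching W u)" by (rule card_sides_le[OF u])
  have d: "card (diameters u) \<le> card (touching W u)" "even (card (diameters u))"
    by (rule card_diameters_le, rule even_card_diameters)
  consider "card (touching W u) = 3" | "card (touching W u) = 4" | "card (touching W u) = 5"
    | "6 \<le> card (touching W u)"
    using k3 by linarith
  then show ?thesis
  proof cases
    case 1
    have "card (facets_through x y) = 2" if "(x, y) \<in> diameters u" for x y
      using triangle_facets_through[OF u 1] diameters_partner(2,3)[OF that] that
      by (auto simp: diameters_def gabriel_pairs_def)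
    then have "diameters u = {}" by (fastforce simp: diameters_def)
    then show ?thesis using s 1 by simp
  next
    case 2
    show ?thesis
    proof (cases "card (diameters u) = 4")
      case True
      then have "fst ` diameters u = touching W u"
        using 2 card_image[OF inj_on_fst_diameters] fst_diameters_subset
        by (intro card_subset_eq finite_touching) auto
      then have "partner u x \<in> touching W u" if x: "x \<in> touching W u" for x
      proof -
        obtain y where "(x, y) \<in> diameters u"
          using x unfolding \<open>fst ` diameters u = touching W u\<close>[symmetric] by auto
        then show ?thesis using diameters_partner(1,3) by metis
      qed
      then have "rect_facet u" using 2 by (simp add: rect_facet_def)
      then show ?thesis using s d 2 by simp
    next
      case False
      then have "card (diameters u) \<le> 2" using d 2 by (auto elim!: evenE)
      then show ?thesis using s 2 by simp
    qed
  next
    case 3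
    then have "card (diameters u) \<le> 4" using d by (auto elim!: evenE)
    then show ?thesis using s 3 by simp
  next
    case 4
    then show ?thesis using s d by simp
  qed
qed

lemma sum_sides_diameters:
  "(\<Sum>u\<in>facet_normals W. card (sides u) + 2 * card (diameters u)) = 2 * card (gabriel_pairs W)"
proof -
  define ft where "ft g = facets_through (fst g) (snd g)" for g
  have ft: "card (ft g) = 1 \<or> card (ft g) = 2" if "g \<in> gabriel_pairs W" for g
    using gabriel_facets_through[of "fst g" "snd g"] that by (auto simp: ft_def)
  have sub: "ft g \<subseteq> facet_normals W" for g by (auto simp: ft_def facets_through_def)
  have swap: "(\<Sum>u\<in>facet_normals W. card {g\<in>gabriel_pairs W. u \<in> ft g \<and> card (ft g) = n}) =
     (\<Sum>g\<in>gabriel_pairs W. if card (ft g) = n then n else 0)" for n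
  proof -
    have "(\<Sum>u\<in>facet_normals W. card {g\<in>gabriel_pairs W. u \<in> ft g \<and> card (ft g) = n}) =
      (\<Sum>g\<in>gabriel_pairs W. card {u\<in>facet_normals W. u \<in> ft g \<and> card (ft g) = n})"
      by (rule sum_card_swap[OF finite_facet_normals finite_gabriel])
    also have "\<dots> = (\<Sum>g\<in>gabriel_pairs W. if card (ft g) = n then n else 0)"
    proof (intro sum.cong refl)
      fix g
      have "{u\<in>facet_normals W. u \<in> ft g \<and> card (ft g) = n} = (if card (ft g)
          = n then ft g else {})"
        using sub[of g] by auto
      then show "card {u\<in>facet_normals W. u \<in> ft g \<and> card (ft g) = n} = (if card (ft g)
          = n then n else 0)"
        by simp
    qed
    finally show ?thesis .
  qed
  have sd: "sides u = {g\<in>gabriel_pairs W. u \<in> ft g \<and> card (ft g) = 2}"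
    "diameters u = {g\<in>gabriel_pairs W. u \<in> ft g \<and> card (ft g) = 1}" for u
    by (auto simp: sides_def diameters_def ft_def)
  have "(\<Sum>u\<in>facet_normals W. card (sides u) + 2 * card (diameters u)) =
     (\<Sum>u\<in>facet_normals W. card (sides u)) + 2 * (\<Sum>u\<in>facet_normals W. card (diameters u))"
    by (simp add: sum.distrib sum_distrib_left)
  also have "\<dots> = (\<Sum>g\<in>gabriel_pairs W. (if card (ft g) = 2 then 2 else 0) + 2 * (if card (ft g)
      = 1 then 1 else 0))"
    unfolding sd swap by (simp add: sum.distrib sum_distrib_left)
  also have "\<dots> = (\<Sum>g\<in>gabriel_pairs W. 2)"
    using ft by (intro sum.cong refl) auto
  finally show ?thesis by simp
qed

lemma sum_rects: "(\<Sum>u\<in>facet_normals W. if rect_facet u then 4 else 0) = (\<Sum>v\<in>W. card (rects v))"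
proof -
  have "(\<Sum>u\<in>facet_normals W. if rect_facet u then 4 else 0) =
      (\<Sum>u\<in>facet_normals W. card {v\<in>W. v \<in> touching W u \<and> rect_facet u})"
  proof (intro sum.cong refl)
    fix u
    have "{v\<in>W. v \<in> touching W u \<and> rect_facet u} = (if rect_facet u then touching W u else {})"
      by (auto simp: touching_def)
    then show "(if rect_facet u then 4 else 0) = card {v\<in>W. v \<in> touching W u \<and> rect_facet u}"
      by (simp add: rect_facet_def)
  qed
  also have "\<dots> = (\<Sum>v\<in>W. card {u\<in>facet_normals W. v \<in> touching W u \<and> rect_facet u})"
    by (rule sum_card_swap[OF finite_facet_normals finite_W])
  finally show ?thesis by (simp add: rects_def)
qed

text \<open>Euler's formula applied to \<open>6 * k = 6 * (k - 2) + 12\<close>; the multiples of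
  \<open>12\<close> and the \<open>24\<close> avoid subtraction of natural numbers.\<close>

lemma sum_facet_bound:
  "(\<Sum>u\<in>facet_normals W. 6 * card (touching W u) + (if rect_facet u then 4 else 0)) + 24
    = 12 * card W + (\<Sum>v\<in>W. card (rects v)) + 12 * card (facet_normals W)"
proof -
  have "(\<Sum>u\<in>facet_normals W. 6 * card (touching W u) + (if rect_facet u then 4 else 0))
    = (\<Sum>u\<in>facet_normals W. 6 * (card (touching W u) - 2) + 12 + (if rect_facet u then 4 else 0))"
    using facet_normalsD(2) by (intro sum.cong refl) fastforce
  also have "\<dots> = 6 * (\<Sum>u\<in>facet_normals W. card (touching W u) - 2) + 12 * card (facet_normals W)
     + (\<Sum>v\<in>W. card (rects v))"
    by (simp add: sum.distrib sum_distrib_left flip: sum_rects)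
  finally show ?thesis
    using sum_facets card_W_ge_2 by simp
qed

lemma sum_facet_count:
  "(\<Sum>u\<in>facet_normals W. card (sides u) + 2 * card (diameters u) + 12)
    = 2 * card (gabriel_pairs W) + 12 * card (facet_normals W)"
  using sum_sides_diameters by (simp add: sum.distrib)

lemma gabriel_bound: "2 * card (gabriel_pairs W) + 24 \<le> 15 * card W"
proof -
  have "(\<Sum>u\<in>facet_normals W. card (sides u) + 2 * card (diameters u) + 12) \<le>
    (\<Sum>u\<in>facet_normals W. 6 * card (touching W u) + (if rect_facet u then 4 else 0))"
    by (intro sum_mono facet_bound)
  moreover have "(\<Sum>v\<in>W. card (rects v)) \<le> (\<Sum>v\<in>W. 3)"
    by (intro sum_mono card_rects_le)
  ultimately show ?thesis
    using sum_facet_bound sum_facet_count by simp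
qed

text \<open>Three rectangles at \<open>v\<close> exhaust the nonacute angles that fit around
  \<open>v\<close>.\<close>

lemma nonacute_imp_rect:
  assumes "v \<in> W" "card (rects v) = 3" "u \<in> nonacute_facets v"
  shows "rect_facet u"
proof -
  have "rects v = nonacute_facets v"
    using card_nonacute_facets_le[OF assms(1)] assms(2)
    by (intro card_seteq finite_nonacute_facets rects_subset_nonacute) simp
  then show ?thesis using assms(3) by (auto simp: rects_def)
qed

lemma acute_if_not_rect:
  assumes "v \<in> W" "card (rects v) = 3" "u \<in> facet_normals W" "\<not> rect_facet u"
    and "v \<in> touching W u" "x \<in> touching W u" "y \<in> touching W u" "x \<noteq> v" "y \<noteq> v"
  shows "0 < (x - v) \<bullet> (y - v)"
proof (rule ccontr)
  assume "\<not> 0 < (x - v) \<bullet> (y - v)"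
  then have "u \<in> nonacute_facets v"
    using assms by (force simp: nonacute_facets_def)
  then show False using nonacute_imp_rect assms by blast
qed

text \<open>Equality of the sums forces equality in every summand. A facet with four or more
  vertices that is no rectangle would then need a diameter, and the right angle over it at a third
  vertex is a nonacute angle besides the three rectangles there.\<close>

lemma gabriel_bound_eqD:
  assumes eq: "2 * card (gabriel_pairs W) + 24 = 15 * card W"
  shows "v \<in> W \<Longrightarrow> card (rects v) = 3"
    and "u \<in> facet_normals W \<Longrightarrow> \<not> rect_facet u \<Longrightarrow> card (touching W u) = 3"
proof -
  let ?f = "\<lambda>u. card (sides u) + 2 * card (diameters u) + 12"
  let ?g = "\<lambda>u. 6 * card (touching W u) + (if rect_facet u then 4 else 0)"
  have fg: "sum ?f (facet_normals W) \<le> sum ?g (facet_normals W)"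
    by (intro sum_mono facet_bound)
  have r: "(\<Sum>v\<in>W. card (rects v)) \<le> (\<Sum>v\<in>W. 3)"
    by (intro sum_mono card_rects_le)
  have "sum ?f (facet_normals W) = sum ?g (facet_normals W)" "(\<Sum>v\<in>W. card (rects v)) = (\<Sum>v\<in>W. 3)"
    using fg r eq sum_facet_bound sum_facet_count by simp_all
  note eqs = this
  show r3: "card (rects v) = 3" if "v \<in> W" for v
    using sum_mono_inv[OF eqs(2) card_rects_le that finite_W] by simp
  show "card (touching W u) = 3" if u: "u \<in> facet_normals W" "\<not> rect_facet u"
  proof (rule ccontr)
    assume "card (touching W u) \<noteq> 3"
    then have "4 \<le> card (touching W u)" using facet_normalsD(2)[OF u(1)] by simp
    moreover have "?f u = ?g u"
      by (rule sum_mono_inv[OF eqs(1) facet_bound u(1) finite_facet_normals])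
    ultimately have "card (diameters u) \<noteq> 0"
      using card_sides_le[OF u(1)] u(2) by simp
    then have "diameters u \<noteq> {}" by auto
    then obtain x y where xy: "(x, y) \<in> diameters u" by auto
    note d = diameters_partner[OF xy]
    obtain z where z: "z \<in> touching W u" "z \<noteq> x" "z \<noteq> y"
      using card_ge_3E[OF facet_normalsD(2)[OF u(1)]] by metis
    have "z \<in> W" using z by (simp add: touching_def)
    have "(x - z) \<bullet> (y - z) = 0"
      using partner_right_angle[OF d(2) _ z(1)] d by simp
    then show False
      using acute_if_not_rect[OF \<open>z \<in> W\<close> r3[OF \<open>z \<in> W\<close>] u z(1) d(2,3)] z by simp
  qed
qed

text \<open>The plane through \<open>x\<close> and \<open>y\<close> with normal \<open>x + y\<close> lies between the planes of the two facets.\<close>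

lemma side_is_gabriel:
  assumes ft: "card (facets_through x y) = 2" and "x \<noteq> y"
    and nonobtuse: "\<And>u z. u \<in> facets_through x y \<Longrightarrow> z \<in> touching W u \<Longrightarrow> z \<noteq> x \<Longrightarrow> z \<noteq> y \<Longrightarrow> 0
        \<le> (x - z) \<bullet> (y - z)"
  shows "(x, y) \<in> gabriel_pairs W"
proof -
  obtain u1 u2 where u: "facets_through x y = {u1, u2}" "u1 \<noteq> u2"
    using ft by (auto simp: card_2_iff)
  have t: "u1 \<in> facet_normals W" "u2 \<in> facet_normals W" "x \<in> touching W u1" "y \<in> touching W u1"
    "x \<in> touching W u2" "y \<in> touching W u2"
    using u by (auto simp: facets_through_def)
  have xy: "x \<in> W" "y \<in> W" "x \<noteq> - y"
    using t touching_not_antipodal by (auto simp: touching_def)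
  have pos: "0 < q + x \<bullet> y" using inner_greater_minus_q[OF xy] by simp
  define u0 where "u0 = (1 / (q + x \<bullet> y)) *\<^sub>R (x + y)"
  have u0: "u0 \<bullet> x = 1" "u0 \<bullet> y = 1"
    using pos on_sphere xy by (simp_all add: u0_def inner_simps inner_commute)
  have iff: "0 \<le> (x - z) \<bullet> (y - z) \<longleftrightarrow> u0 \<bullet> z \<le> 1" if "z \<in> W" for z
    using nonobtuse_iff[OF xy(1,2) that] pos by (simp add: u0_def)
  define k where "k = cross3 x y"
  have k: "cross3 x y \<noteq> 0" using cross3_touching_nonzero[OF t(3,4)] \<open>x \<noteq> y\<close> .
  obtain a where a: "u2 = u1 + a *\<^sub>R k"
    unfolding k_def using t k by (auto simp: touching_def intro: facets_through_cross3[of u1 x y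
        u2])
  obtain b where b: "u0 = u1 + b *\<^sub>R k"
    unfolding k_def using t k u0 by (auto simp: touching_def intro: facets_through_cross3[of u1 x
        y u0])
  have "a \<noteq> 0" using a u(2) by auto
  \<comment> \<open>The normals of planes through \<open>x\<close> and \<open>y\<close> lie on a
    line, and \<open>s\<close> locates \<open>u0\<close> with respect to \<open>u1\<close> and
    \<open>u2\<close>. A third vertex of each facet shows that \<open>u0\<close> lies between them,
    so its values on \<open>W\<close> are averages of values at most 1.\<close>
  define s where "s = b / a"
  have u0z: "u0 \<bullet> z = (1 - s) * (u1 \<bullet> z) + s * (u2 \<bullet> z)" for z
    using \<open>a \<noteq> 0\<close> by (simp add: a b s_def inner_add_left algebra_simps)
  have lt: "w' \<bullet> z < 1" if "z \<in> touching W w" "z \<noteq> x" "z \<noteq> y" "w \<in> {u1, u2}" "w' \<in> {u1, u2}" "w \<noteq>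
      w'" for z w w'
  proof -
    have "w' \<bullet> z \<noteq> 1"
    proof
      assume "w' \<bullet> z = 1"
      then have "{x, y, z} \<subseteq> touching W w" "{x, y, z} \<subseteq> touching W w'"
        using that t by (auto simp: touching_def)
      then show False using normal_eqI[of x y z w w'] that \<open>x \<noteq> y\<close> by auto
    qed
    moreover have "w' \<bullet> z \<le> 1" using that t facet_normalsD(1) by (auto simp: touching_def)
    ultimately show ?thesis by simp
  qed
  obtain z1 where z1: "z1 \<in> touching W u1" "z1 \<noteq> x" "z1 \<noteq> y"
    using card_ge_3E[OF facet_normalsD(2)[OF t(1)]] by metis
  obtain z2 where z2: "z2 \<in> touching W u2" "z2 \<noteq> x" "z2 \<noteq> y"
    using card_ge_3E[OF facet_normalsD(2)[OF t(2)]] by metis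
  have zW: "z1 \<in> W" "u1 \<bullet> z1 = 1" "z2 \<in> W" "u2 \<bullet> z2 = 1"
    using z1 z2 by (auto simp: touching_def)
  have "u0 \<bullet> z1 \<le> 1" "u0 \<bullet> z2 \<le> 1"
    using nonobtuse[of u1 z1] nonobtuse[of u2 z2] z1 z2 u iff zW by auto
  then have "0 \<le> s * (1 - u2 \<bullet> z1)" "0 \<le> (1 - s) * (1 - u1 \<bullet> z2)"
    unfolding u0z zW by (simp_all add: algebra_simps)
  moreover have "0 < 1 - u2 \<bullet> z1" "0 < 1 - u1 \<bullet> z2"
    using lt[OF z1, of u2] lt[OF z2, of u1] u(2) by auto
  ultimately have s: "0 \<le> s" "0 \<le> 1 - s"
    by (auto simp: zero_le_mult_iff)
  have "u0 \<bullet> z \<le> 1" if "z \<in> W" for z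
  proof -
    have "(1 - s) * (u1 \<bullet> z) \<le> (1 - s) * 1" "s * (u2 \<bullet> z) \<le> s * 1"
      using mult_left_mono[OF facet_normalsD(1)[OF t(1) that] s(2)]
        mult_left_mono[OF facet_normalsD(1)[OF t(2) that] s(1)] by blast+
    then show ?thesis unfolding u0z by simp
  qed
  then show ?thesis
    using iff xy \<open>x \<noteq> y\<close> by (auto simp: gabriel_pairs_def)
qed

text \<open>Seen from \<open>z\<close>, the pair either spans a diagonal, at a right angle, or
  contains the point opposite to \<open>z\<close>. In the second case the diagonal from
  \<open>z\<close> is the sum of two orthogonal sides.\<close>

lemma rect_facet_nonobtuse:
  assumes "rect_facet u" "u \<in> facet_normals W" and T: "x \<in> touching W u" "y \<in> touching W u" "z \<in>
      touching W u"
    and "z \<noteq> x" "z \<noteq> y" "x \<noteq> y"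
  shows "0 \<le> (x - z) \<bullet> (y - z)"
proof -
  have p: "partner u w \<in> touching W u" if "w \<in> touching W u" for w
    using assms(1) that by (simp add: rect_facet_def)
  have diag: "0 \<le> (partner u z - z) \<bullet> (y - z)" if y: "y \<in> touching W u" for y
  proof -
    have "partner u z - z = (y - z) + (partner u y - z)"
      by (simp add: partner_def)
    then have "(partner u z - z) \<bullet> (y - z) = (y - z) \<bullet> (y - z) + (y - z) \<bullet> (partner u y - z)"
      by (metis inner_add_left inner_commute)
    also have "\<dots> = (y - z) \<bullet> (y - z)"
      using partner_right_angle[OF y p[OF y] T(3)] by simp
    finally show ?thesis by simp
  qed
  consider "x = partner u z" | "y = partner u z" | "x \<noteq> partner u z" "y \<noteq> partner u z" by blast
  then show ?thesis
  proof cases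
    case 1
    then show ?thesis using diag[OF T(2)] by simp
  next
    case 2
    then show ?thesis using diag[OF T(1)] by (simp add: inner_commute)
  next
    case 3
    then have "y = partner u x"
      using rect_facet_cases(1)[OF assms(1,2) T(3,1)] T assms by auto
    then show ?thesis using partner_right_angle[OF T(1) p[OF T(1)] T(3)] by simp
  qed
qed

text \<open>Every estimate becomes sharp: a triangle contributes six ordered sides, a rectangle
  eight ordered sides and four ordered diagonals, all of them Gabriel pairs.\<close>

lemma gabriel_bound_eqI:
  assumes r3: "\<And>v. v \<in> W \<Longrightarrow> card (rects v) = 3"
    and faces: "\<And>u. u \<in> facet_normals W \<Longrightarrow> rect_facet u \<or> card (touching W u) = 3"
  shows "2 * card (gabriel_pairs W) + 24 = 15 * card W"
proof -
  have nonobtuse: "0 \<le> (x - z) \<bullet> (y - z)"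
    if "u \<in> facet_normals W" "x \<in> touching W u" "y \<in> touching W u" "z \<in> touching W u" "z \<noteq> x" "z \<noteq>
        y" "x \<noteq> y" for u x y z
    using rect_facet_nonobtuse[of u x y z] acute_if_not_rect[of z u x y] r3[of z] that
    by (cases "rect_facet u") (auto simp: touching_def)
  have side: "(x, y) \<in> sides u"
    if u: "u \<in> facet_normals W" "x \<in> touching W u" "y \<in> touching W u" "x \<noteq> y"
        and c: "card (facets_through x y) = 2" for u x y
  proof -
    have "(x, y) \<in> gabriel_pairs W"
    proof (rule side_is_gabriel[OF c u(4)])
      fix w z assume "w \<in> facets_through x y" "z \<in> touching W w" "z \<noteq> x" "z \<noteq> y"
      then show "0 \<le> (x - z) \<bullet> (y - z)"
        using nonobtuse[of w x y z] u(4) by (simp add: facets_through_def)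
    qed
    then show ?thesis using c u by (auto simp: sides_def facets_through_def)
  qed
  have eq: "card (sides u) + 2 * card (diameters u) + 12 = 6 * card (touching W u)
      + (if rect_facet u then 4 else 0)"
    if u: "u \<in> facet_normals W" for u
  proof (cases "rect_facet u")
    case False
    let ?T = "touching W u"
    have T3: "card ?T = 3" using faces[OF u] False by simp
    have "?T \<times> ?T - (\<lambda>x. (x, x)) ` ?T \<subseteq> sides u"
      using side[OF u] triangle_facets_through[OF u T3] by auto
    then have "card (?T \<times> ?T - (\<lambda>x. (x, x)) ` ?T) \<le> card (sides u)"
      by (rule card_mono[OF finite_sides])
    moreover have "card (?T \<times> ?T - (\<lambda>x. (x, x)) ` ?T) = 6"
      using T3 finite_touching
      by (subst card_Diff_subset) (auto simp: card_image inj_on_def card_cartesian_product)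
    ultimately show ?thesis
      using facet_bound[OF u] T3 False by simp
  next
    case True
    let ?T = "touching W u"
    have T4: "card ?T = 4" and p: "\<And>x. x \<in> ?T \<Longrightarrow> partner u x \<in> ?T"
      using True by (auto simp: rect_facet_def)
    have two: "card (facets_through x y) = 2" if xy: "x \<in> ?T" "y \<in> ?T" "y \<noteq> x" "y \<noteq> partner u x"
        for x y
    proof (rule two_facets_through_cross3[OF u xy(1,2)])
      show "x \<noteq> y" using xy by simp
      fix w assume w: "w \<in> ?T" "w \<noteq> x" "w \<noteq> y"
      note R = rect_facet_cases[OF True u xy]
      have "cross3 x y \<bullet> (x + partner u x) = cross3 x y \<bullet> (y + partner u y)" using R(3) by simp
      then have "cross3 x y \<bullet> partner u x = cross3 x y \<bullet> partner u y"
        by (simp add: inner_add_right cross3_inner_zero)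
      moreover have "w = partner u x \<or> w = partner u y" using R(1) w by auto
      ultimately show "cross3 x y \<bullet> w = cross3 x y \<bullet> partner u x" by auto
    qed
    have one: "(x, partner u x) \<in> diameters u" if x: "x \<in> ?T" for x
    proof -
      define y where "y = partner u x"
      have y: "y \<in> ?T" "y \<noteq> x" using p[OF x] partner_neq[OF u x] by (auto simp: y_def)
      have xy: "x \<in> W" "y \<in> W" "x \<noteq> - y"
        using x y touching_not_antipodal by (auto simp: touching_def)
      have pos: "0 < q + x \<bullet> y" using inner_greater_minus_q[OF xy] by simp
      have "0 \<le> (x - z) \<bullet> (y - z)" if "z \<in> W" for z
        using nonobtuse_iff[OF xy(1,2) that] partner_sum[OF x] y facet_normalsD(1)[OF u that] pos
        by (simp add: y_def)
      then have G: "(x, y) \<in> gabriel_pairs W"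
        using xy y by (auto simp: gabriel_pairs_def)
      \<comment> \<open>The diagonals share their midpoint. A supporting plane through one diagonal
        has average level 1 at the ends of the other, hence level 1 at both, and is the plane of
        \<open>u\<close>.\<close>
      have "w = u" if w: "w \<in> facets_through x y" for w
      proof -
        obtain z where z: "z \<in> ?T" "z \<noteq> x" "z \<noteq> y"
          using card_ge_3E[OF facet_normalsD(2)[OF u]] by metis
        have "x + y = z + partner u z"
          using rect_facet_cases(3)[OF True u x z(1,2)] z by (simp add: y_def)
        then have "w \<bullet> x + w \<bullet> y = w \<bullet> z + w \<bullet> partner u z"
          by (metis inner_add_right)
        moreover have "w \<bullet> x = 1" "w \<bullet> y = 1" "w \<bullet> z \<le> 1" "w \<bullet> partner u z \<le> 1"
          using w z p[OF z(1)] facet_normalsD(1)[of w] by (auto simp: facets_through_def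
              touching_def)
        ultimately have "w \<bullet> z = 1" by simp
        then have "{x, y, z} \<subseteq> touching W w" "{x, y, z} \<subseteq> touching W u"
          using w z x y by (auto simp: facets_through_def touching_def)
        then show ?thesis using normal_eqI[of x y z w u] z y by auto
      qed
      moreover have "u \<in> facets_through x y" using u x y by (simp add: facets_through_def)
      ultimately have "facets_through x y = {u}" by blast
      then show ?thesis using G by (simp add: diameters_def y_def)
    qed
    let ?D = "(\<lambda>x. (x, x)) ` ?T" and ?P = "(\<lambda>x. (x, partner u x)) ` ?T"
    have "?P \<subseteq> diameters u" using one by auto
    then have "card ?P \<le> card (diameters u)" by (rule card_mono[OF finite_diameters])
    moreover have "card ?P = 4" using T4 by (simp add: card_image inj_on_def)
    moreover have "(x, y) \<in> sides u" if "x \<in> ?T" "y \<in> ?T" "y \<noteq> x" "y \<noteq> partner u x" for x y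
      using side[OF u that(1,2)] two[OF that] that(3) by blast
    then have "?T \<times> ?T - (?D \<union> ?P) \<subseteq> sides u"
      by (auto simp: image_iff)
    then have "card (?T \<times> ?T - (?D \<union> ?P)) \<le> card (sides u)"
      by (rule card_mono[OF finite_sides])
    moreover have "card (?T \<times> ?T - (?D \<union> ?P)) = 8"
    proof -
      have "?D \<inter> ?P = {}" using partner_neq[OF u] p by fastforce
      then have "card (?D \<union> ?P) = 8"
        using T4 finite_touching by (subst card_Un_disjoint) (auto simp: card_image inj_on_def)
      moreover have "?D \<union> ?P \<subseteq> ?T \<times> ?T" using p by auto
      ultimately show ?thesis
        using T4 finite_touching by (simp add: card_Diff_subset card_cartesian_product)
    qed
    ultimately show ?thesis
      using facet_bound[OF u] T4 True by simp
  qed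
  have "(\<Sum>u\<in>facet_normals W. card (sides u) + 2 * card (diameters u) + 12) =
    (\<Sum>u\<in>facet_normals W. 6 * card (touching W u) + (if rect_facet u then 4 else 0))"
    by (intro sum.cong refl eq)
  moreover have "(\<Sum>v\<in>W. card (rects v)) = (\<Sum>v\<in>W. 3)"
    by (intro sum.cong refl r3)
  ultimately show ?thesis
    using sum_facet_bound sum_facet_count by simp
qed

end

section \<open>Faces of the convex hull\<close>

text \<open>The tangent plane of the sphere at \<open>v\<close> separates \<open>v\<close> strictly
  from all other points.\<close>

lemma extreme_point_of_hull_on_sphere:
  fixes S :: "'a::euclidean_space set"
  assumes "finite S" and S: "\<And>w. w \<in> S \<Longrightarrow> w \<bullet> w = q"
  shows "v extreme_point_of (convex hull S) \<longleftrightarrow> v \<in> S"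
proof (rule extreme_point_of_convex_hull_convex_independent)
  show "compact S" using \<open>finite S\<close> by (rule finite_imp_compact)
  show "v \<notin> convex hull (S - {v})" if "v \<in> S" for v
  proof -
    have "v \<bullet> w < q" if w: "w \<in> S - {v}" for w
    proof -
      have "0 < (v - w) \<bullet> (v - w)" using w by auto
      then show ?thesis
        using S[of w] S[of v] w \<open>v \<in> S\<close> by (simp add: inner_simps inner_commute)
    qed
    then have "S - {v} \<subseteq> {w. v \<bullet> w < q}" by blast
    then have "convex hull (S - {v}) \<subseteq> {w. v \<bullet> w < q}"
      by (rule hull_minimal) (rule convex_halfspace_lt)
    then show ?thesis using S[OF that] by auto
  qed
qed

text \<open>The diagonal direction \<open>f\<close> separates: because the sides at \<open>a\<close>
  are orthogonal, \<open>f\<close> is strictly larger at the other three corners.\<close>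

lemma vertex_of_rectangle:
  fixes a b c d :: "'a::real_inner"
  assumes "a \<noteq> b" "a \<noteq> d" "c - b = d - a" "orthogonal (b - a) (d - a)"
  shows "a \<notin> convex hull {b, c, d}"
proof -
  define f where "f = (b - a) + (d - a)"
  have c: "c = a + f" using assms(3) by (simp add: f_def algebra_simps)
  have o: "(b - a) \<bullet> (d - a) = 0" using assms(4) by (simp add: orthogonal_def)
  have pos: "0 < (b - a) \<bullet> (b - a)" "0 < (d - a) \<bullet> (d - a)" using assms by simp_all
  have "f \<bullet> (b - a) = (b - a) \<bullet> (b - a)" "f \<bullet> (d - a) = (d - a) \<bullet> (d - a)"
    using o unfolding f_def inner_add_left by (simp_all add: inner_commute)
  moreover have "f \<bullet> f = f \<bullet> (b - a) + f \<bullet> (d - a)" by (metis f_def inner_add_right)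
  ultimately have "0 < f \<bullet> (b - a)" "0 < f \<bullet> (d - a)" "0 < f \<bullet> f" using pos by linarith+
  then have "{b, c, d} \<subseteq> {x. f \<bullet> a < f \<bullet> x}"
    by (auto simp: c inner_diff_right inner_add_right)
  then have "convex hull {b, c, d} \<subseteq> {x. f \<bullet> x > f \<bullet> a}"
    by (rule hull_minimal) (rule convex_halfspace_gt)
  then show ?thesis by auto
qed

lemma acute_angle_at:
  assumes "0 < (b - a) \<bullet> (c - a)"
  shows "angle_at a b c < pi / 2"
proof -
  have "b \<noteq> a" "c \<noteq> a" using assms by auto
  then have n: "0 < norm (b - a) * norm (c - a)" by simp
  define t where "t = (b - a) \<bullet> (c - a) / (norm (b - a) * norm (c - a))"
  have "0 < t" using assms n by (simp add: t_def)
  moreover have "t \<le> 1" using norm_cauchy_schwarz[of "b - a" "c - a"] n by (simp add: t_def)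
  ultimately have "arccos t < arccos 0" by (intro arccos_less_arccos) auto
  then show ?thesis by (simp add: angle_at_def t_def)
qed

context symmetric_sphere_set
begin

text \<open>With \<open>n = card W\<close> the planar bound gives \<open>4 * n + 24\<close>, which
  is below \<open>15 * n\<close> from \<open>n = 3\<close> on. A single antipodal pair has no
  Gabriel pairs at all.\<close>

lemma gabriel_bound_nonspanning:
  assumes "a \<noteq> 0" and "\<And>w. w \<in> W \<Longrightarrow> a \<bullet> w = 0" and "W \<noteq> {}"
  shows "2 * card (gabriel_pairs W) + 24 < 15 * card W"
proof -
  obtain w where w: "w \<in> W" using assms by blast
  have "w \<noteq> - w"
  proof
    assume "w = - w"
    then have "w \<bullet> w = - (w \<bullet> w)" by (metis inner_minus_left)
    then show False using on_sphere[OF w] q_pos by simp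
  qed
  then have two: "card {w, - w} = 2" "{w, - w} \<subseteq> W" using w uminus_W by auto
  show ?thesis
  proof (cases "W = {w, - w}")
    case True
    have "gabriel_pairs {w, - w} = {}" by (auto simp: gabriel_pairs_def)
    then have "card (gabriel_pairs W) = 0" "card W = 2" using True two(1) by (metis card.empty)+
    then show ?thesis by simp
  next
    case False
    then have "{w, - w} \<subset> W" using two by blast
    then have "2 < card W" using psubset_card_mono[OF finite_W] two by metis
    then show ?thesis using gabriel_planar_le[OF assms(1,2)] by linarith
  qed
qed

end

context spanning_sphere_set
begin

lemma facet_hull_eq:
  assumes "u \<noteq> 0" and le: "\<And>w. w \<in> W \<Longrightarrow> u \<bullet> w \<le> 1"
  shows "convex hull W \<inter> {x. u \<bullet> x = 1} face_of convex hull W"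
    and "convex hull W \<inter> {x. u \<bullet> x = 1} = convex hull (touching W u)"
proof -
  have "convex hull W \<subseteq> {x. u \<bullet> x \<le> 1}"
    using le by (intro hull_minimal convex_halfspace_le) auto
  then show face: "convex hull W \<inter> {x. u \<bullet> x = 1} face_of convex hull W"
    by (intro face_of_Int_supporting_hyperplane_le convex_convex_hull) auto
  obtain S where S: "S \<subseteq> W" "convex hull W \<inter> {x. u \<bullet> x = 1} = convex hull S"
    using face_of_convex_hull_subset[OF finite_imp_compact[OF finite_W] face] .
  have "S \<subseteq> touching W u"
    using S hull_subset[of S convex] by (auto simp: touching_def)
  then have "convex hull S \<subseteq> convex hull (touching W u)" by (rule hull_mono)
  moreover have "convex hull (touching W u) \<subseteq> convex hull W \<inter> {x. u \<bullet> x = 1}"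
    by (intro hull_minimal convex_Int convex_convex_hull convex_hyperplane)
      (auto simp: touching_def hull_inc)
  ultimately show "convex hull W \<inter> {x. u \<bullet> x = 1} = convex hull (touching W u)"
    using S(2) by blast
qed

lemma hull_touching_Int: "convex hull (touching W u) \<inter> W = touching W u"
proof -
  have "convex hull (touching W u) \<subseteq> {x. u \<bullet> x = 1}"
    by (intro hull_minimal convex_hyperplane) (auto simp: touching_def)
  then show ?thesis
    using hull_subset[of "touching W u" convex] by (auto simp: touching_def)
qed

lemma not_in_hyperplane: "convex hull W \<subseteq> {x. a \<bullet> x = b} \<Longrightarrow> a = 0"
proof -
  assume "convex hull W \<subseteq> {x. a \<bullet> x = b}"
  then have eq: "a \<bullet> w = b" if "w \<in> W" for w using hull_inc[OF that, of convex] by blast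
  have "a \<bullet> w = 0" if "w \<in> W" for w
    using eq[OF that] eq[OF uminus_W[OF that]] by simp
  then show "a = 0" by (rule spanning)
qed

lemma two_faces_hull: "two_faces (convex hull W) = (\<lambda>u. convex hull (touching W u)) `
    facet_normals W"
proof (intro equalityI subsetI)
  fix F assume "F \<in> (\<lambda>u. convex hull (touching W u)) ` facet_normals W"
  then obtain u where u: "u \<in> facet_normals W" and F: "F = convex hull (touching W u)" by blast
  obtain x y z where xyz: "x \<in> touching W u" "y \<in> touching W u" "y \<noteq> x" "z \<in> touching W u" "z \<noteq> x"
      "z \<noteq> y"
    using card_ge_3E[OF facet_normalsD(2)[OF u]] by metis
  have "u \<noteq> 0" using xyz by (auto simp: touching_def)
  have "F face_of convex hull W"
    using facet_hull_eq[OF \<open>u \<noteq> 0\<close>] facet_normalsD(1)[OF u] unfolding F by metis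
  moreover have "aff_dim F = 2"
  proof -
    have "\<not> collinear {x, y, z}"
      using not_collinear_on_sphere[of x q y z] xyz on_sphere by (auto simp: touching_def)
    then have "1 < aff_dim {x, y, z}" by (simp add: collinear_aff_dim)
    also have "\<dots> \<le> aff_dim (touching W u)" using xyz by (intro aff_dim_subset) auto
    finally have "1 < aff_dim (touching W u)" .
    moreover have "aff_dim (touching W u) \<le> aff_dim {x. u \<bullet> x = 1}"
      by (intro aff_dim_subset) (auto simp: touching_def)
    then have "aff_dim (touching W u) \<le> 2" using \<open>u \<noteq> 0\<close> by simp
    ultimately show ?thesis by (simp add: F aff_dim_convex_hull)
  qed
  ultimately show "F \<in> two_faces (convex hull W)" by (simp add: two_faces_def)
next
  fix F assume "F \<in> two_faces (convex hull W)"
  then have face: "F face_of convex hull W" and dim: "aff_dim F = 2" by (auto simp: two_faces_def)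
  then have "F exposed_face_of convex hull W"
    using exposed_face_of_polyhedron[OF polyhedron_convex_hull[OF finite_W]] by blast
  then obtain a b where ab: "convex hull W \<subseteq> {x. a \<bullet> x \<le> b}" "F = convex hull W \<inter> {x. a \<bullet> x = b}"
    unfolding exposed_face_of_def by blast
  have le: "a \<bullet> w \<le> b" if "w \<in> W" for w using ab(1) hull_inc[OF that, of convex] by blast
  \<comment> \<open>At level 0, symmetry and spanning force \<open>a = 0\<close>; then
    \<open>F\<close> would be the whole hull, which is not contained in a plane.\<close>
  have "b \<noteq> 0"
  proof
    assume "b = 0"
    have zero: "a \<bullet> w = 0" if "w \<in> W" for w
      using le[OF that] le[OF uminus_W[OF that]] \<open>b = 0\<close> by simp
    then have "a = 0" by (rule spanning)
    then have "F = convex hull W" using ab \<open>b = 0\<close> by simp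
    then have "aff_dim (convex hull W) < DIM(real^3)" using dim by simp
    then obtain a' b' where "a' \<noteq> 0" "convex hull W \<subseteq> {x. a' \<bullet> x = b'}"
      by (rule aff_lowdim_subset_hyperplane)
    then show False using not_in_hyperplane by blast
  qed
  moreover obtain w where w: "w \<in> W" using card_W_ge_2 by fastforce
  then have "0 \<le> b" using le[OF w] le[OF uminus_W[OF w]] by simp
  ultimately have "0 < b" by simp
  define u where "u = (1 / b) *\<^sub>R a"
  have ub: "u \<bullet> x = 1 \<longleftrightarrow> a \<bullet> x = b" "u \<bullet> x \<le> 1 \<longleftrightarrow> a \<bullet> x \<le> b" for x
    using \<open>0 < b\<close> by (auto simp: u_def field_simps)
  have F: "F = convex hull W \<inter> {x. u \<bullet> x = 1}" using ab(2) ub by simp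
  have "u \<noteq> 0"
    using dim unfolding F by auto
  then have F': "F = convex hull (touching W u)"
    using facet_hull_eq(2)[of u] le ub F by simp
  then have "2 = aff_dim (touching W u)" using dim by (simp add: aff_dim_convex_hull)
  also have "\<dots> \<le> int (card (touching W u)) - 1"
    by (rule aff_dim_le_card[OF finite_touching])
  finally have "u \<in> facet_normals W"
    using le ub by (simp add: facet_normals_def)
  with F' show "F \<in> (\<lambda>u. convex hull (touching W u)) ` facet_normals W" by blast
qed

lemma touching_subset_of_hull_eq:
  assumes "convex hull (touching W u) = convex hull S"
  shows "touching W u \<subseteq> S"
proof
  fix v assume "v \<in> touching W u"
  then have "v extreme_point_of convex hull (touching W u)"
    using extreme_point_of_hull_on_sphere[OF finite_touching, of u q v] on_sphere
        by (auto simp: touching_def)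
  then show "v \<in> S" unfolding assms by (rule extreme_point_of_convex_hull)
qed

text \<open>The converse of Thales: the right angle puts \<open>z\<close> on the plane through
  \<open>x\<close> and \<open>y\<close> with normal \<open>x + y\<close>, which therefore is the
  plane of \<open>u\<close>.\<close>

lemma right_angle_partner:
  assumes T: "x \<in> touching W u" "y \<in> touching W u" "z \<in> touching W u" and d: "x \<noteq> y" "x \<noteq> z" "y \<noteq> z"
    and "(x - z) \<bullet> (y - z) = 0"
  shows "y = partner u x"
proof -
  have W: "x \<in> W" "y \<in> W" "x \<noteq> - y" "z \<in> W"
    using T touching_not_antipodal by (auto simp: touching_def)
  define w where "w = (1 / (q + x \<bullet> y)) *\<^sub>R (x + y)"
  have pos: "0 < q + x \<bullet> y" using inner_greater_minus_q[OF W(1-3)] by simp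
  have "(x + y) \<bullet> z = q + x \<bullet> y"
    using assms(7) on_sphere[OF W(4)] by (simp add: inner_simps inner_commute)
  then have "{x, y, z} \<subseteq> touching W w"
    using W pos on_sphere by (auto simp: touching_def w_def inner_simps inner_commute)
  then have "w = u" using normal_eqI[of x y z w u] T d by simp
  then show ?thesis using partner_gabriel_normal[OF W(1-3)] by (simp add: w_def)
qed

lemma is_rectangle_hull_iff:
  assumes u: "u \<in> facet_normals W"
  shows "is_rectangle (convex hull (touching W u)) \<longleftrightarrow> rect_facet u"
proof
  assume "is_rectangle (convex hull (touching W u))"
  then obtain a b c d where R: "a \<noteq> b" "a \<noteq> d" "c - b = d - a" "orthogonal (b - a) (d - a)"
    and eq: "convex hull (touching W u) = convex hull {a, b, c, d}"
    unfolding is_rectangle_def by blast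
  have sub: "touching W u \<subseteq> {a, b, c, d}" by (rule touching_subset_of_hull_eq[OF eq])
  \<comment> \<open>The conditions on a rectangle are invariant under cyclic relabelling of its
    corners, so the statement for the first corner serves all four.\<close>
  have vertex: "a \<in> touching W u" if "a \<noteq> b" "a \<noteq> d" "c - b = d - a" "orthogonal (b - a) (d - a)"
      "convex hull (touching W u) = convex hull {a, b, c, d}" "touching W u \<subseteq> {a, b, c, d}"
          for a b c d
  proof (rule ccontr)
    assume "a \<notin> touching W u"
    then have "touching W u \<subseteq> {b, c, d}" using that(6) by blast
    then have "convex hull (touching W u) \<subseteq> convex hull {b, c, d}" by (rule hull_mono)
    moreover have "a \<in> convex hull {a, b, c, d}" by (simp add: hull_inc)
    ultimately show False using vertex_of_rectangle[OF that(1-4)] that(5) by blast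
  qed
  have c: "c = b + d - a" using R(3) by (simp add: algebra_simps)
  have o: "(b - a) \<bullet> (d - a) = 0" using R(4) by (simp add: orthogonal_def)
  have "a \<in> touching W u" by (rule vertex[OF R eq sub])
  moreover have "b \<in> touching W u"
    by (rule vertex[of b c a d]) (use R o eq sub c in \<open>auto simp: orthogonal_def insert_commute
        inner_simps inner_commute\<close>)
  moreover have "c \<in> touching W u"
    by (rule vertex[of c d b a]) (use R o eq sub c in \<open>auto simp: orthogonal_def insert_commute
        inner_simps inner_commute\<close>)
  moreover have "d \<in> touching W u"
    by (rule vertex[of d a c b]) (use R o eq sub c in \<open>auto simp: orthogonal_def insert_commute
        inner_simps inner_commute\<close>)
  ultimately have T: "touching W u = {a, b, c, d}" "a \<in> touching W u" "b \<in> touching W u" "c \<in>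
      touching W u" "d \<in> touching W u"
    using sub by auto
  have "b \<noteq> d" using o R by auto
  have "a \<noteq> c"
  proof
    assume "a = c"
    then have "b - a = - (d - a)" using c by (simp add: algebra_simps)
    then show False using o R by (metis inner_eq_zero_iff inner_minus_left neg_equal_0_iff_equal
        right_minus_eq)
  qed
  have ne: "b \<noteq> c" "c \<noteq> d" using R c by auto
  have "(a - b) \<bullet> (c - b) = 0"
    using o by (simp add: c inner_simps inner_commute)
  then have pa: "c = partner u a"
    using right_angle_partner[OF T(2,4,3)] \<open>a \<noteq> c\<close> R ne by simp
  moreover have "d = partner u b"
    using right_angle_partner[OF T(3,5,2)] \<open>b \<noteq> d\<close> R o by simp
  ultimately have "partner u a = c" "partner u c = a" "partner u b = d" "partner u d = b"
    using partner_partner by simp_all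
  then show "rect_facet u"
    using R ne \<open>a \<noteq> c\<close> \<open>b \<noteq> d\<close> by (auto simp: rect_facet_def T(1))
next
  assume R: "rect_facet u"
  obtain x where x: "x \<in> touching W u" using card_ge_3E[OF facet_normalsD(2)[OF u]] by metis
  obtain y where y: "y \<in> touching W u" "y \<noteq> x" "y \<noteq> partner u x"
    using card_ge_3E[OF facet_normalsD(2)[OF u]] by metis
  note C = rect_facet_cases[OF R u x y]
  have "partner u y \<in> touching W u" using R y by (simp add: rect_facet_def)
  then have "orthogonal (y - x) (partner u y - x)"
    using partner_right_angle[OF y(1) _ x] by (simp add: orthogonal_def)
  moreover have "partner u x - y = partner u y - x" using C(3) by (simp add: algebra_simps)
  moreover have "x \<noteq> y" "x \<noteq> partner u y" using C(2) by auto
  moreover have "touching W u = {x, y, partner u x, partner u y}" using C(1) by auto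
  then have "convex hull (touching W u) = convex hull {x, y, partner u x, partner u y}"
      by (rule arg_cong)
  ultimately show "is_rectangle (convex hull (touching W u))"
    unfolding is_rectangle_def by blast
qed

lemma is_triangle_hull:
  assumes "u \<in> facet_normals W" "is_triangle (convex hull (touching W u))"
  shows "card (touching W u) = 3"
proof -
  obtain a b c where "convex hull (touching W u) = convex hull {a, b, c}"
    using assms(2) unfolding is_triangle_def by blast
  then have "touching W u \<subseteq> {a, b, c}" by (rule touching_subset_of_hull_eq)
  then have "card (touching W u) \<le> card {a, b, c}" by (intro card_mono) auto
  also have "\<dots> \<le> 3" by (simp add: card_insert_if)
  finally show ?thesis using facet_normalsD(2)[OF assms(1)] by simp
qed

lemma is_acute_triangle_hull:
  assumes "card (touching W u) = 3"
    and acute: "\<And>x y z. \<lbrakk>x \<in> touching W u; y \<in> touching W u; z \<in> touching W u; x \<noteq> z; y \<noteq> z\<rbrakk>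
        \<Longrightarrow> 0 < (x - z) \<bullet> (y - z)"
  shows "is_acute_triangle (convex hull (touching W u))"
proof -
  obtain a b c where T: "touching W u = {a, b, c}" "a \<noteq> b" "a \<noteq> c" "b \<noteq> c"
    using assms(1) by (auto simp: card_3_iff)
  have "\<not> collinear {a, b, c}"
    using not_collinear_on_sphere[of a q b c] T on_sphere by (auto simp: touching_def)
  moreover have "angle_at a b c < pi / 2" "angle_at b c a < pi / 2" "angle_at c a b < pi / 2"
    by (rule acute_angle_at, rule acute; use T in simp)+
  ultimately show ?thesis
    unfolding is_acute_triangle_def T(1)
    by (intro exI[of _ a] exI[of _ b] exI[of _ c] conjI refl)
qed

lemma three_rectangles_iff:
  "three_rectangles_at_each_vertex (convex hull W) \<longleftrightarrow> (\<forall>v\<in>W. card (rects v) = 3)"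
proof -
  have "card {F \<in> two_faces (convex hull W). is_rectangle F \<and> v \<in> F} = card (rects v)"
      if v: "v \<in> W" for v
  proof -
    have "{F \<in> two_faces (convex hull W). is_rectangle F \<and> v \<in> F}
        = (\<lambda>u. convex hull (touching W u)) ` rects v"
      using is_rectangle_hull_iff v hull_touching_Int by (fastforce simp: two_faces_hull rects_def)
    moreover have "inj_on (\<lambda>u. convex hull (touching W u)) (rects v)"
    proof (rule inj_onI)
      fix u w assume *: "u \<in> rects v" "w \<in> rects v" "convex hull (touching W u)
          = convex hull (touching W w)"
      then have "touching W u = touching W w" using hull_touching_Int by metis
      then show "u = w" using * inj_on_touching by (auto simp: rects_def inj_on_def)
    qed
    ultimately show ?thesis by (simp add: card_image)
  qed
  then show ?thesis
    unfolding three_rectangles_at_each_vertex_def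
    using extreme_point_of_hull_on_sphere[OF finite_W on_sphere] by (simp add: Ball_def)
qed

end

section \<open>Double-normal pairs\<close>

lemma card_symmetric_relation:
  fixes R :: "('a \<times> 'a) set"
  assumes "finite R" and irrefl: "\<And>x. (x, x) \<notin> R" and sym: "\<And>x y. (x, y) \<in> R \<Longrightarrow> (y, x) \<in> R"
  shows "card R = 2 * card {{x, y} | x y. (x, y) \<in> R}"
proof -
  define f :: "'a \<times> 'a \<Rightarrow> 'a set" where "f = (\<lambda>(x, y). {x, y})"
  have fib: "card {r \<in> R. f r = e} = 2" if e: "e \<in> f ` R" for e
  proof -
    obtain x y where xy: "(x, y) \<in> R" "e = {x, y}" using e by (auto simp: f_def)
    then have "{r \<in> R. f r = e} = {(x, y), (y, x)}"
      using sym by (auto simp: f_def doubleton_eq_iff)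
    moreover have "x \<noteq> y" using xy irrefl by auto
    ultimately show ?thesis by simp
  qed
  have "card R = (\<Sum>e\<in>f ` R. \<Sum>r | r \<in> R \<and> f r = e. 1)"
    using sum.image_gen[OF \<open>finite R\<close>, of "\<lambda>_. 1::nat" f] by simp
  also have "\<dots> = (\<Sum>e\<in>f ` R. 2)"
    using fib by (intro sum.cong refl) simp
  also have "f ` R = {{x, y} | x y. (x, y) \<in> R}"
    by (force simp: f_def image_iff)
  finally show ?thesis by simp
qed

lemma symmetric_union_sphere_set:
  assumes "finite V" "0 < r" "V \<subseteq> sphere (0 :: real^3) r"
  shows "symmetric_sphere_set (V \<union> uminus ` V) (r\<^sup>2)"
proof
  have "v \<bullet> v = r\<^sup>2" if "v \<in> V" for v
    using that assms by (auto simp: power2_norm_eq_inner[symmetric])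
  then show "w \<bullet> w = r\<^sup>2" if "w \<in> V \<union> uminus ` V" for w using that by auto
qed (use assms in auto)

text \<open>In ordered pairs. An antipodal pair in \<open>V\<close> is always double-normal, its
  bounding planes being tangent to the sphere; these pairs give the first term. Any other pair
  \<open>(p, q)\<close> corresponds to \<open>(q, - p)\<close>.\<close>

lemma double_normal_number_gabriel:
  fixes V :: "(real^3) set"
  assumes V: "finite V" "0 < r" "V \<subseteq> sphere 0 r"
  defines "W \<equiv> V \<union> uminus ` V"
  shows "2 * double_normal_number V = card (V \<inter> uminus ` V)
      + card {(x, y) \<in> gabriel_pairs W. x \<in> V \<and> - y \<in> V}"
proof -
  interpret symmetric_sphere_set W "r\<^sup>2"
    unfolding W_def by (rule symmetric_union_sphere_set[OF V])
  define R where "R = {(p, q). p \<in> V \<and> q \<in> V \<and> p \<noteq> q \<and> V \<subseteq> strip p q}"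
  define A where "A = {(x, y) \<in> gabriel_pairs W. x \<in> V \<and> - y \<in> V}"
  have VW: "v \<in> W" if "v \<in> V" for v using that by (simp add: W_def)
  \<comment> \<open>On the sphere the two bounds of the strip are opposite numbers, so the lower
    bound at \<open>z\<close> is the upper bound at \<open>- z\<close>. This is why the reflected
    points enter.\<close>
  have strip: "V \<subseteq> strip p q \<longleftrightarrow> (\<forall>z\<in>W. (q - p) \<bullet> z \<le> r\<^sup>2 - p \<bullet> q)" if pq: "p \<in> V" "q \<in> V" for p q
  proof -
    have n: "p \<bullet> p = r\<^sup>2" "q \<bullet> q = r\<^sup>2" using on_sphere VW pq by auto
    have "V \<subseteq> strip p q \<longleftrightarrow> (\<forall>z\<in>V. (q - p) \<bullet> z \<le> r\<^sup>2 - p \<bullet> q \<and> (q - p) \<bullet> (- z) \<le> r\<^sup>2 - p \<bullet> q)"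
      using n by (auto simp: strip_def inner_simps inner_commute subset_iff)
    also have "\<dots> \<longleftrightarrow> (\<forall>z\<in>W. (q - p) \<bullet> z \<le> r\<^sup>2 - p \<bullet> q)"
      by (auto simp: W_def ball_Un simp del: inner_minus_right)
    finally show ?thesis .
  qed
  have gab: "(q, - p) \<in> gabriel_pairs W \<longleftrightarrow> q \<noteq> - p \<and> p \<noteq> q \<and> V \<subseteq> strip p q" if pq: "p \<in> V" "q \<in> V"
      for p q
  proof -
    have m: "q \<in> W" "- p \<in> W" using pq VW uminus_W by auto
    have "(\<forall>z\<in>W. 0 \<le> (q - z) \<bullet> (- p - z)) \<longleftrightarrow> (\<forall>z\<in>W. (q - p) \<bullet> z \<le> r\<^sup>2 - p \<bullet> q)"
      using nonobtuse_iff[OF m] by (simp add: inner_commute)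
    then show ?thesis
      using strip[OF pq] m by (auto simp: gabriel_pairs_def)
  qed
  have "finite R"
    by (rule finite_subset[of _ "V \<times> V"]) (auto simp: R_def V(1))
  have "strip p q = strip q p" for p q :: "real^3"
    by (auto simp: strip_def inner_diff_right)
  then have "card R = 2 * card {{p, q} | p q. (p, q) \<in> R}"
    using \<open>finite R\<close> by (intro card_symmetric_relation) (auto simp: R_def)
  also have "{{p, q} | p q. (p, q) \<in> R} = double_normal_pairs V"
    by (simp add: R_def double_normal_pairs_def)
  finally have "2 * double_normal_number V = card R"
    by (simp add: double_normal_number_def)
  also have "R = (\<lambda>p. (p, - p)) ` (V \<inter> uminus ` V) \<union> (\<lambda>(x, y). (- y, x)) ` A"
  proof (intro equalityI subsetI)
    fix g assume "g \<in> R"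
    then obtain p q where g: "g = (p, q)" "p \<in> V" "q \<in> V" "p \<noteq> q" "V \<subseteq> strip p q"
      by (auto simp: R_def)
    show "g \<in> (\<lambda>p. (p, - p)) ` (V \<inter> uminus ` V) \<union> (\<lambda>(x, y). (- y, x)) ` A"
    proof (cases "q = - p")
      case True
      then have "p \<in> V \<inter> uminus ` V" using g by (auto intro: image_eqI[of _ _ q])
      then show ?thesis using g True by blast
    next
      case False
      then have "(q, - p) \<in> A" using gab[OF g(2,3)] g by (auto simp: A_def)
      then show ?thesis using g by (intro UnI2 image_eqI[of _ _ "(q, - p)"]) auto
    qed
  next
    fix g assume "g \<in> (\<lambda>p. (p, - p)) ` (V \<inter> uminus ` V) \<union> (\<lambda>(x, y). (- y, x)) ` A"
    then consider p where "g = (p, - p)" "p \<in> V" "- p \<in> V" | x y where "g = (- y, x)" "(x, y) \<in> A"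
    proof
      assume "g \<in> (\<lambda>p. (p, - p)) ` (V \<inter> uminus ` V)" and thesis: "\<And>p. g = (p, - p) \<Longrightarrow> p \<in> V
          \<Longrightarrow> - p \<in> V \<Longrightarrow> thesis"
      then obtain p where p: "g = (p, - p)" "p \<in> V" "p \<in> uminus ` V" by blast
      then have "- p \<in> V" by auto
      with p thesis show thesis by blast
    qed auto
    then show "g \<in> R"
    proof cases
      case 1
      have n: "p \<bullet> p = r\<^sup>2" using on_sphere VW 1 by auto
      have "- (p \<bullet> z) \<le> r\<^sup>2" if "z \<in> W" for z
        using inner_greater_minus_q[OF VW[OF 1(2)] that] on_sphere[OF that] by (cases "p
            = - z") auto
      then have "V \<subseteq> strip p (- p)"
        unfolding strip[OF 1(2,3)] inner_diff_left inner_minus_left inner_minus_right n by fastforce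
      moreover have "p \<noteq> - p"
      proof
        assume "p = - p"
        then have "p \<bullet> p = - (p \<bullet> p)" by (metis inner_minus_left)
        then show False using n q_pos by simp
      qed
      ultimately show ?thesis using 1 by (simp add: R_def)
    next
      case 2
      then have "(x, - (- y)) \<in> gabriel_pairs W" "- y \<in> V" "x \<in> V" by (auto simp: A_def)
      then show ?thesis using gab[of "- y" x] 2 by (simp add: R_def)
    qed
  qed
  also have "card \<dots> = card ((\<lambda>p. (p, - p)) ` (V \<inter> uminus ` V)) + card ((\<lambda>(x, y). (- y, x)) ` A)"
  proof (rule card_Un_disjoint)
    show "finite ((\<lambda>p. (p, - p)) ` (V \<inter> uminus ` V))" using V(1) by simp
    show "finite ((\<lambda>(x, y). (- y, x)) ` A)"
      by (intro finite_imageI finite_subset[OF _ finite_gabriel]) (auto simp: A_def)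
    show "(\<lambda>p. (p, - p)) ` (V \<inter> uminus ` V) \<inter> (\<lambda>(x, y). (- y, x)) ` A = {}"
      by (auto simp: A_def gabriel_pairs_def)
  qed
  also have "card ((\<lambda>p. (p, - p)) ` (V \<inter> uminus ` V)) = card (V \<inter> uminus ` V)"
    by (rule card_image) (auto simp: inj_on_def)
  also have "card ((\<lambda>(x, y). (- y, x)) ` A) = card A"
    by (rule card_image) (auto simp: inj_on_def)
  finally show ?thesis by (simp add: A_def)
qed

text \<open>The reflection turns the pairs counted into those with \<open>- x\<close> and
  \<open>y\<close> in \<open>V\<close>. The union of both kinds lies among the Gabriel pairs of
  \<open>W\<close>; a pair of both kinds has its points in \<open>P\<close>, and it remains Gabriel
  there since \<open>P\<close> has fewer points to test.\<close>

lemma mixed_gabriel_pairs_le: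
  fixes V :: "(real^3) set"
  assumes "finite V"
  defines "W \<equiv> V \<union> uminus ` V" and "P \<equiv> V \<inter> uminus ` V"
  shows "2 * card {(x, y) \<in> gabriel_pairs W. x \<in> V \<and> - y \<in> V} \<le> card (gabriel_pairs W)
      + card (gabriel_pairs P)"
proof -
  define A where "A = {(x, y) \<in> gabriel_pairs W. x \<in> V \<and> - y \<in> V}"
  define B where "B = {(x, y) \<in> gabriel_pairs W. - x \<in> V \<and> y \<in> V}"
  have fin: "finite (gabriel_pairs W)"
    by (rule finite_subset[of _ "W \<times> W"]) (auto simp: gabriel_pairs_def W_def assms(1))
  have AB: "A \<subseteq> gabriel_pairs W" "B \<subseteq> gabriel_pairs W" by (auto simp: A_def B_def)
  have neg: "(- x, - y) \<in> gabriel_pairs W" if "(x, y) \<in> gabriel_pairs W" for x y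
  proof -
    have W: "- z \<in> W" if "z \<in> W" for z using that by (auto simp: W_def)
    have "0 \<le> (- x - z) \<bullet> (- y - z)" if "z \<in> W" for z
    proof -
      have "0 \<le> (x - - z) \<bullet> (y - - z)" using \<open>(x, y) \<in> _\<close> W[OF \<open>z \<in> W\<close>] unfolding
          gabriel_pairs_def by blast
      also have "\<dots> = (- x - z) \<bullet> (- y - z)" by (simp add: inner_simps inner_commute)
      finally show ?thesis .
    qed
    then show ?thesis using \<open>(x, y) \<in> _\<close> W by (auto simp: gabriel_pairs_def)
  qed
  have "B = (\<lambda>(x, y). (- x, - y)) ` A"
  proof (intro equalityI subsetI)
    fix g assume "g \<in> B"
    then obtain x y where "g = (x, y)" "(x, y) \<in> gabriel_pairs W" "- x \<in> V" "y \<in> V"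
        by (auto simp: B_def)
    then show "g \<in> (\<lambda>(x, y). (- x, - y)) ` A"
      using neg by (intro image_eqI[of _ _ "(- x, - y)"]) (auto simp: A_def)
  qed (use neg in \<open>auto simp: A_def B_def\<close>)
  moreover have "inj_on (\<lambda>(x, y). (- x, - y)) A" by (auto simp: inj_on_def)
  ultimately have "card B = card A" by (simp add: card_image)
  moreover have "card A + card B = card (A \<union> B) + card (A \<inter> B)"
    using AB fin by (intro card_Un_Int) (auto intro: finite_subset)
  moreover have "card (A \<union> B) \<le> card (gabriel_pairs W)"
    using AB fin by (intro card_mono) auto
  moreover have "A \<inter> B \<subseteq> gabriel_pairs P"
  proof
    fix g assume "g \<in> A \<inter> B"
    then obtain x y where g: "g = (x, y)" "(x, y) \<in> gabriel_pairs W" "x \<in> V" "- x \<in> V" "y \<in> V" "-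
        y \<in> V"
      by (auto simp: A_def B_def)
    then have "x \<in> P" "y \<in> P" by (auto simp: P_def intro: image_eqI[of _ _ "- x"] image_eqI[of _ _
        "- y"])
    moreover have "P \<subseteq> W" by (auto simp: P_def W_def)
    ultimately show "g \<in> gabriel_pairs P" using g by (auto simp: gabriel_pairs_def)
  qed
  then have "card (A \<inter> B) \<le> card (gabriel_pairs P)"
  proof (intro card_mono)
    show "finite (gabriel_pairs P)"
      by (rule finite_subset[of _ "P \<times> P"]) (auto simp: gabriel_pairs_def P_def assms(1))
  qed
  ultimately show ?thesis by (simp add: A_def)
qed

context symmetric_sphere_set
begin

lemma gabriel_bound_nonempty:
  assumes "W \<noteq> {}"
  shows "2 * card (gabriel_pairs W) + 24 \<le> 15 * card W"
    and "2 * card (gabriel_pairs W) + 24 = 15 * card W \<Longrightarrow> spanning_sphere_set W q"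
proof -
  have "2 * card (gabriel_pairs W) + 24 < 15 * card W \<or> spanning_sphere_set W q
      \<and> 2 * card (gabriel_pairs W) + 24 \<le> 15 * card W"
  proof (cases "\<exists>a. a \<noteq> 0 \<and> (\<forall>w\<in>W. a \<bullet> w = 0)")
    case True
    then show ?thesis using gabriel_bound_nonspanning assms by blast
  next
    case False
    then have spans: "a = 0" if "\<And>w. w \<in> W \<Longrightarrow> a \<bullet> w = 0" for a using that by blast
    interpret spanning_sphere_set W q by unfold_locales (rule spans)
    show ?thesis using gabriel_bound spanning_sphere_set_axioms by blast
  qed
  then show "2 * card (gabriel_pairs W) + 24 \<le> 15 * card W"
    "2 * card (gabriel_pairs W) + 24 = 15 * card W \<Longrightarrow> spanning_sphere_set W q" by auto
qed

end

lemma symmetric_double_normal_number: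
  fixes V :: "(real^3) set"
  assumes V: "finite V" "0 < r" "V \<subseteq> sphere 0 r" and sym: "uminus ` V = V"
  shows "8 * double_normal_number V + 48 = 34 * card V \<longleftrightarrow> 2 * card (gabriel_pairs V) + 24
      = 15 * card V"
proof -
  have "{(x, y) \<in> gabriel_pairs V. x \<in> V \<and> - y \<in> V} = gabriel_pairs V"
    using sym by (auto simp: gabriel_pairs_def)
  then have "2 * double_normal_number V = card V + card (gabriel_pairs V)"
    using double_normal_number_gabriel[OF V] sym by simp
  then show ?thesis by linarith
qed

lemma symmetric_around_0_iff:
  fixes V :: "(real^3) set"
  shows "symmetric_around 0 V \<longleftrightarrow> uminus ` V = V"
proof
  assume "symmetric_around 0 V"
  then have neg: "- x \<in> V" if "x \<in> V" for x using that by (simp add: symmetric_around_def)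
  then have "x \<in> uminus ` V" if "x \<in> V" for x using neg[OF that]
      by (intro image_eqI[of _ _ "- x"]) auto
  with neg show "uminus ` V = V" by auto
qed (auto simp: symmetric_around_def)

text \<open>With \<open>card W + card P = 2 * card V\<close>, adding the bounds for \<open>W\<close>
  and \<open>P\<close> gives \<open>8 * double_normal_number V + 48 \<le> 30 * card V + 4 * card
  P\<close>, so equality needs \<open>card P = card V\<close>.\<close>

lemma double_normal_bound:
  fixes V :: "(real^3) set"
  assumes V: "finite V" "0 < r" "V \<subseteq> sphere 0 r" and "8 \<le> card V"
  shows "8 * double_normal_number V + 48 \<le> 34 * card V"
    and "8 * double_normal_number V + 48 = 34 * card V \<Longrightarrow> uminus ` V = V"
proof -
  define W P where "W = V \<union> uminus ` V" and "P = V \<inter> uminus ` V"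
  interpret W: symmetric_sphere_set W "r\<^sup>2"
    unfolding W_def by (rule symmetric_union_sphere_set[OF V])
  have sub: "P \<subseteq> W" "P \<subseteq> V" by (auto simp: P_def W_def)
  interpret P: symmetric_sphere_set P "r\<^sup>2"
  proof
    show "finite P" using V by (simp add: P_def)
    show "- w \<in> P" if "w \<in> P" for w using that by (auto simp: P_def)
  qed (use sub W.on_sphere V in auto)
  have WP: "card W + card P = 2 * card V"
    using card_Un_Int[of V "uminus ` V"] V card_image[of uminus V] by (simp add: W_def P_def)
  have "W \<noteq> {}" using \<open>8 \<le> card V\<close> by (auto simp: W_def)
  have N: "2 * double_normal_number V = card P + card {(x, y) \<in> gabriel_pairs W. x \<in> V \<and> - y \<in> V}"
    unfolding W_def P_def by (rule double_normal_number_gabriel[OF V])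
  have mix: "2 * card {(x, y) \<in> gabriel_pairs W. x \<in> V \<and> - y \<in> V} \<le> card (gabriel_pairs W)
      + card (gabriel_pairs P)"
    unfolding W_def P_def by (rule mixed_gabriel_pairs_le[OF V(1)])
  have GW: "2 * card (gabriel_pairs W) + 24 \<le> 15 * card W"
    by (rule W.gabriel_bound_nonempty(1)[OF \<open>W \<noteq> {}\<close>])
  have PV: "card P \<le> card V" using sub V by (intro card_mono) auto
  have "8 * double_normal_number V + 48 \<le> 34 * card V \<and> (8 * double_normal_number V + 48
      = 34 * card V \<longrightarrow> card P = card V)"
  proof (cases "P = {}")
    \<comment> \<open>Without a symmetric part the left side is only bounded by
      \<open>30 * card V + 24\<close>, which is less than \<open>34 * card V\<close> for the given
      size of \<open>V\<close>.\<close>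
    case True
    then have "gabriel_pairs P = {}" by (auto simp: gabriel_pairs_def)
    then show ?thesis using N mix GW WP True \<open>8 \<le> card V\<close> by simp
  next
    case False
    then have "2 * card (gabriel_pairs P) + 24 \<le> 15 * card P"
      by (rule P.gabriel_bound_nonempty(1))
    then show ?thesis using N mix GW WP PV by linarith
  qed
  moreover have "uminus ` V = V" if "card P = card V"
  proof -
    have "P = V" using that sub V by (intro card_subset_eq) auto
    then have "V \<subseteq> uminus ` V" by (auto simp: P_def)
    then show ?thesis using V(1) by (intro card_subset_eq[symmetric]) (auto simp: card_image)
  qed
  ultimately show "8 * double_normal_number V + 48 \<le> 34 * card V"
    "8 * double_normal_number V + 48 = 34 * card V \<Longrightarrow> uminus ` V = V" by auto
qed

lemma symmetric_sphere_setI: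
  fixes V :: "(real^3) set"
  assumes "finite V" "0 < r" "V \<subseteq> sphere 0 r" "uminus ` V = V"
  shows "symmetric_sphere_set V (r\<^sup>2)"
  using symmetric_union_sphere_set[OF assms(1-3)] assms(4) by simp

lemma double_normal_eq_structure:
  fixes V :: "(real^3) set"
  assumes V: "finite V" "0 < r" "V \<subseteq> sphere 0 r" and "8 \<le> card V"
    and eq: "8 * double_normal_number V + 48 = 34 * card V"
  shows "(\<forall>F \<in> two_faces (convex hull V). is_rectangle F \<or> is_acute_triangle F)
    \<and> three_rectangles_at_each_vertex (convex hull V)"
proof -
  have sym: "uminus ` V = V" using double_normal_bound(2)[OF assms] .
  interpret symmetric_sphere_set V "r\<^sup>2" by (rule symmetric_sphere_setI[OF V sym])
  have eqV: "2 * card (gabriel_pairs V) + 24 = 15 * card V"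
    using symmetric_double_normal_number[OF V sym] eq by simp
  have "V \<noteq> {}" using \<open>8 \<le> card V\<close> by auto
  interpret spanning_sphere_set V "r\<^sup>2"
    by (rule gabriel_bound_nonempty(2)[OF \<open>V \<noteq> {}\<close> eqV])
  note r3 = gabriel_bound_eqD(1)[OF eqV] and tri = gabriel_bound_eqD(2)[OF eqV]
  have "is_rectangle (convex hull (touching V u)) \<or> is_acute_triangle (convex hull (touching V u))"
    if u: "u \<in> facet_normals V" for u
  proof (cases "rect_facet u")
    case True
    then show ?thesis using is_rectangle_hull_iff[OF u] by simp
  next
    case False
    have "is_acute_triangle (convex hull (touching V u))"
    proof (rule is_acute_triangle_hull[OF tri[OF u False]])
      fix x y z assume T: "x \<in> touching V u" "y \<in> touching V u" "z \<in> touching V u" "x \<noteq> z" "y \<noteq> z"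
      then have "z \<in> V" by (simp add: touching_def)
      then show "0 < (x - z) \<bullet> (y - z)"
        using acute_if_not_rect[OF _ r3 u False] T by blast
    qed
    then show ?thesis ..
  qed
  then show ?thesis using r3 by (auto simp: two_faces_hull three_rectangles_iff)
qed

lemma double_normal_eqI:
  fixes V :: "(real^3) set"
  assumes V: "finite V" "0 < r" "V \<subseteq> sphere 0 r" and "V \<noteq> {}" and sym: "uminus ` V = V"
    and faces: "\<forall>F \<in> two_faces (convex hull V). is_rectangle F \<or> is_triangle F"
    and three: "three_rectangles_at_each_vertex (convex hull V)"
  shows "8 * double_normal_number V + 48 = 34 * card V"
proof -
  interpret symmetric_sphere_set V "r\<^sup>2" by (rule symmetric_sphere_setI[OF V sym])
  \<comment> \<open>If \<open>V\<close> lay in a plane through the centre, the hull itself would be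
    its only possible two-dimensional face, and no vertex could belong to three rectangles.\<close>
  have spans: "a = 0" if a: "\<And>v. v \<in> V \<Longrightarrow> a \<bullet> v = 0" for a
  proof (rule ccontr)
    assume "a \<noteq> 0"
    have "aff_dim (convex hull V) \<le> aff_dim {x. a \<bullet> x = 0}"
      using a by (intro aff_dim_subset hull_minimal convex_hyperplane) auto
    then have "aff_dim (convex hull V) \<le> 2" using \<open>a \<noteq> 0\<close> by simp
    then have sub: "two_faces (convex hull V) \<subseteq> {convex hull V}"
      using face_of_aff_dim_lt[OF convex_convex_hull] by (fastforce simp: two_faces_def)
    obtain v where v: "v \<in> V" using \<open>V \<noteq> {}\<close> by blast
    then have "v extreme_point_of convex hull V"
      using extreme_point_of_hull_on_sphere[OF finite_W on_sphere] by simp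
    then have "card {F \<in> two_faces (convex hull V). is_rectangle F \<and> v \<in> F} = 3"
      using three by (simp add: three_rectangles_at_each_vertex_def)
    moreover have "card {F \<in> two_faces (convex hull V). is_rectangle F \<and> v \<in> F}
        \<le> card {convex hull V}"
      using sub by (intro card_mono) auto
    ultimately show False by simp
  qed
  interpret spanning_sphere_set V "r\<^sup>2" by unfold_locales (rule spans)
  have "2 * card (gabriel_pairs V) + 24 = 15 * card V"
  proof (rule gabriel_bound_eqI)
    show "card (rects v) = 3" if "v \<in> V" for v
      using three that by (simp add: three_rectangles_iff)
    show "rect_facet u \<or> card (touching V u) = 3" if u: "u \<in> facet_normals V" for u
      using faces u is_rectangle_hull_iff[OF u] is_triangle_hull[OF u]
          by (auto simp: two_faces_hull)
  qed
  then show ?thesis using symmetric_double_normal_number[OF V sym] by simp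
qed

section \<open>Reduction to a sphere centred at the origin\<close>

lemma strip_translation: "strip (c + p) (c + q) = (+) c ` strip p q"
proof (intro equalityI subsetI)
  fix x assume "x \<in> strip (c + p) (c + q)"
  then have "x - c \<in> strip p q" by (simp add: strip_def inner_diff_left inner_add_left)
  then show "x \<in> (+) c ` strip p q" by (intro image_eqI[of _ _ "x - c"]) auto
qed (auto simp: strip_def inner_add_left)

lemma double_normal_number_translation: "double_normal_number ((+) c ` V) = double_normal_number V"
proof -
  have sub: "(+) c ` V \<subseteq> strip (c + p) (c + q) \<longleftrightarrow> V \<subseteq> strip p q" for p q
    unfolding strip_translation by (rule inj_image_subset_iff) simp
  have "double_normal_pairs ((+) c ` V) = (`) ((+) c) ` double_normal_pairs V"
  proof (intro equalityI subsetI)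
    fix e assume "e \<in> double_normal_pairs ((+) c ` V)"
    then obtain p q where "e = {c + p, c + q}" "p \<in> V" "q \<in> V" "p \<noteq> q" "V \<subseteq> strip p q"
      unfolding double_normal_pairs_def using sub by fastforce
    then have "{p, q} \<in> double_normal_pairs V" "e = (+) c ` {p, q}"
      unfolding double_normal_pairs_def by auto
    then show "e \<in> (`) ((+) c) ` double_normal_pairs V" by blast
  next
    fix e assume "e \<in> (`) ((+) c) ` double_normal_pairs V"
    then obtain p q where "e = (+) c ` {p, q}" "p \<in> V" "q \<in> V" "p \<noteq> q" "V \<subseteq> strip p q"
      unfolding double_normal_pairs_def by blast
    then have "e = {c + p, c + q}" "c + p \<in> (+) c ` V" "c + q \<in> (+) c ` V" "c + p \<noteq> c + q"
      "(+) c ` V \<subseteq> strip (c + p) (c + q)"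
      using sub by auto
    then show "e \<in> double_normal_pairs ((+) c ` V)"
      unfolding double_normal_pairs_def by blast
  qed
  moreover have "inj_on ((`) ((+) c)) (double_normal_pairs V)"
    by (rule inj_onI) (simp add: inj_image_eq_iff)
  ultimately show ?thesis by (simp add: double_normal_number_def card_image)
qed

lemma symmetric_around_translation: "symmetric_around c ((+) c ` V) \<longleftrightarrow> symmetric_around 0 V"
proof -
  have "2 *\<^sub>R c - (c + x) = c + - x" for x by (simp add: scaleR_2)
  then have "2 *\<^sub>R c - (c + x) \<in> (+) c ` V \<longleftrightarrow> - x \<in> V" for x
    by (metis (no_types, lifting) add_left_cancel image_iff)
  then show ?thesis by (simp add: symmetric_around_def)
qed

lemma two_faces_translation: "two_faces ((+) c ` S) = (`) ((+) c) ` two_faces S"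
proof (intro equalityI subsetI)
  fix F assume F: "F \<in> two_faces ((+) c ` S)"
  have eq: "(+) c ` ((+) (- c) ` F) = F" by (auto simp: image_image)
  have "(+) c ` ((+) (- c) ` F) face_of (+) c ` S" using F unfolding eq by (simp add: two_faces_def)
  then have "(+) (- c) ` F face_of S" unfolding face_of_translation_eq .
  moreover have "aff_dim ((+) (- c) ` F) = 2"
    unfolding aff_dim_translation_eq using F by (simp add: two_faces_def)
  ultimately have "(+) (- c) ` F \<in> two_faces S" unfolding two_faces_def by blast
  then show "F \<in> (`) ((+) c) ` two_faces S" using eq by (metis image_eqI)
qed (auto simp: two_faces_def aff_dim_translation_eq)

lemma is_rectangle_translation: "is_rectangle ((+) c ` F) \<longleftrightarrow> is_rectangle F"
proof -
  have imp: "is_rectangle ((+) c ` F)" if F: "is_rectangle F" for c :: 'a and F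
  proof -
    obtain x y z w where "x \<noteq> y" "x \<noteq> w" "z - y = w - x" "orthogonal (y - x) (w - x)" "F
        = convex hull {x, y, z, w}"
      using F unfolding is_rectangle_def by blast
    then show ?thesis
      unfolding is_rectangle_def
      by (intro exI[of _ "c + x"] exI[of _ "c + y"] exI[of _ "c + z"] exI[of _ "c + w"])
        (simp flip: convex_hull_translation)
  qed
  have "(+) (- c) ` ((+) c ` F) = F" by (auto simp: image_image)
  then show ?thesis using imp[of F c] imp[of "(+) c ` F" "- c"] by auto
qed

lemma collinear_translation: "collinear ((+) c ` S) \<longleftrightarrow> collinear S"
  by (simp add: collinear_def)

lemma is_triangle_translation: "is_triangle ((+) c ` F) \<longleftrightarrow> is_triangle F"
proof -
  have imp: "is_triangle ((+) c ` F)" if F: "is_triangle F" for c :: 'a and F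
  proof -
    obtain x y z where "\<not> collinear {x, y, z}" "F = convex hull {x, y, z}"
      using F unfolding is_triangle_def by blast
    then show ?thesis
      unfolding is_triangle_def using collinear_translation[of c "{x, y, z}"]
      by (intro exI[of _ "c + x"] exI[of _ "c + y"] exI[of _ "c + z"])
        (simp flip: convex_hull_translation)
  qed
  have "(+) (- c) ` ((+) c ` F) = F" by (auto simp: image_image)
  then show ?thesis using imp[of F c] imp[of "(+) c ` F" "- c"] by auto
qed

lemma is_acute_triangle_translation:
  assumes "is_acute_triangle F"
  shows "is_acute_triangle ((+) c ` F)"
proof -
  obtain x y z where "\<not> collinear {x, y, z}" "F = convex hull {x, y, z}"
    "angle_at x y z < pi / 2" "angle_at y z x < pi / 2" "angle_at z x y < pi / 2"
    using assms unfolding is_acute_triangle_def by blast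
  then show ?thesis
    unfolding is_acute_triangle_def using collinear_translation[of c "{x, y, z}"]
    by (intro exI[of _ "c + x"] exI[of _ "c + y"] exI[of _ "c + z"])
      (simp add: angle_at_def flip: convex_hull_translation)
qed

lemma three_rectangles_translation:
  "three_rectangles_at_each_vertex ((+) c ` S) \<longleftrightarrow> three_rectangles_at_each_vertex S"
proof -
  have card: "card {F \<in> two_faces ((+) c ` S). is_rectangle F \<and> c + v \<in> F} =
      card {F \<in> two_faces S. is_rectangle F \<and> v \<in> F}" for v
  proof -
    have "{F \<in> two_faces ((+) c ` S). is_rectangle F \<and> c + v \<in> F} =
        (`) ((+) c) ` {F \<in> two_faces S. is_rectangle F \<and> v \<in> F}"
      by (auto simp: two_faces_translation is_rectangle_translation)
    moreover have "inj_on ((`) ((+) c)) {F \<in> two_faces S. is_rectangle F \<and> v \<in> F}"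
      by (rule inj_onI) (simp add: inj_image_eq_iff)
    ultimately show ?thesis by (simp add: card_image)
  qed
  have shift: "(\<forall>v. P v) \<longleftrightarrow> (\<forall>v. P (c + v))" for P by (metis add.commute diff_add_cancel)
  show ?thesis
    unfolding three_rectangles_at_each_vertex_def
    by (subst shift) (simp only: extreme_point_of_translation_eq card)
qed

theorem theorem3:
  fixes V :: "(real^3) set" and c :: "real^3" and r :: real
  assumes "finite V" and "0 < r" and "V \<subseteq> sphere c r"
  shows "(8 \<le> card V \<longrightarrow>
            real (double_normal_number V) \<le> 17/4 * real (card V) - 6 \<and>
            (real (double_normal_number V) = 17/4 * real (card V) - 6 \<longrightarrow>
               symmetric_around c V \<and>
               (\<forall>F \<in> two_faces (convex hull V). is_rectangle F \<or> is_acute_triangle F) \<and>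
               three_rectangles_at_each_vertex (convex hull V)))
       \<and> (V \<noteq> {} \<and> symmetric_around c V \<and>
          (\<forall>F \<in> two_faces (convex hull V). is_rectangle F \<or> is_triangle F) \<and>
          three_rectangles_at_each_vertex (convex hull V) \<longrightarrow>
            real (double_normal_number V) = 17/4 * real (card V) - 6)"
proof -
  define U where "U = (+) (- c) ` V"
  have VU: "V = (+) c ` U" by (auto simp: U_def image_image)
  have U: "finite U" "0 < r" "U \<subseteq> sphere 0 r"
    using assms by (auto simp: U_def dist_norm norm_minus_commute)
  have card: "card V = card U" unfolding VU by (simp add: card_image)
  have N: "double_normal_number V = double_normal_number U"
    unfolding VU by (rule double_normal_number_translation)
  have sym: "symmetric_around c V \<longleftrightarrow> uminus ` U = U"
    unfolding VU symmetric_around_translation symmetric_around_0_iff ..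
  have hull: "convex hull V = (+) c ` (convex hull U)"
    unfolding VU by (rule convex_hull_translation)
  \<comment> \<open>Multiplied by \<open>8\<close> and freed of subtraction, the real bound becomes
    a statement on natural numbers.\<close>
  have le: "real (double_normal_number V) \<le> 17/4 * real (card V) - 6 \<longleftrightarrow> 8 * double_normal_number U + 48 \<le> 34 * card U"
    unfolding N card by linarith
  have eq: "real (double_normal_number V) = 17/4 * real (card V) - 6 \<longleftrightarrow> 8 * double_normal_number U + 48 = 34 * card U"
    unfolding N card by linarith
  have 1: "8 * double_normal_number U + 48 \<le> 34 * card U \<and> (8 * double_normal_number U + 48 = 34 * card U \<longrightarrow>
      uminus ` U = U \<and> (\<forall>F \<in> two_faces (convex hull V). is_rectangle F \<or> is_acute_triangle F) \<and>
      three_rectangles_at_each_vertex (convex hull V))" if "8 \<le> card U"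
  proof -
    have "\<forall>F \<in> two_faces (convex hull V). is_rectangle F \<or> is_acute_triangle F"
      if "\<forall>F \<in> two_faces (convex hull U). is_rectangle F \<or> is_acute_triangle F"
      using that is_acute_triangle_translation
      unfolding hull two_faces_translation by (auto simp: is_rectangle_translation)
    then show ?thesis
      using double_normal_bound[OF U that] double_normal_eq_structure[OF U that]
      unfolding hull three_rectangles_translation by blast
  qed
  have 2: "8 * double_normal_number U + 48 = 34 * card U"
    if "V \<noteq> {}" "uminus ` U = U" "\<forall>F \<in> two_faces (convex hull V). is_rectangle F \<or> is_triangle F"
      "three_rectangles_at_each_vertex (convex hull V)"
    using that VU unfolding hull two_faces_translation three_rectangles_translation
    by (intro double_normal_eqI[OF U]) (auto simp: is_rectangle_translation is_triangle_translation)
  show ?thesis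
    unfolding le eq sym using 1 2 by (simp only: card) blast
qed

end
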